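(* There is an algorithm which, given a domino set $\mathcal{R}$, generates in finite time a Sudoku rule $\mathcal{S}$ (with some width $N$ and digit set $\Sigma$) and an initial condition $\mathcal{C}$ (with some period $q$), such that the $\mathcal{R}$-domino problem is solvable on $\mathbb{N}^2$ if and only if the $(\mathcal{S},\mathcal{C})$-Sudoku puzzle is solvable.
   Context: $\mathbb{N}=\{0,1,2,\dots\}$, $e_1=(1,0)$, $e_2=(0,1)$. A domino set is a triple $\mathcal{R}=(\mathcal{W},\mathcal{R}_1,\mathcal{R}_2)$ with $\mathcal{W}$ a non-empty finite set and $\mathcal{R}_1,\mathcal{R}_2\subset\mathcal{W}^2$; an $\mathcal{R}$-domino function on $\Omega\subset\mathbb{Z}^2$ is $\mathcal{T}:\Omega\to\mathcal{W}$ with $(\mathcal{T}(s),\mathcal{T}(s+e_i))\in\mathcal{R}_i$ whenever $s,s+e_i\in\Omega$, and the problem is solvable on $\Omega$ if such $\mathcal{T}$ exists. Sudoku puzzles: given a natural number $N$ (width) and a non-empty finite set $\Sigma$ (digit set), the Sudoku board is $\mathbb{B}=\{0,\dots,N-1\}\times\mathbb{Z}$. For $j,i\in\mathbb{Z}$ the non-vertical line $\ell_{j,i}=\{(n,jn+i):0\le n\le N-1\}$. A Sudoku rule is a set $\mathcal{S}$ of functions $g:\{0,\dots,N-1\}\to\Sigma$. An $\mathcal{S}$-Sudoku solution is $F:\mathbb{B}\to\Sigma$ such that for all $j,i\in\mathbb{Z}$ the function $n\mapsto F(n,jn+i)$ lies in $\mathcal{S}$. An initial condition with period $q\ge1$ is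 a set $\mathcal{C}\subset(\mathbb{Z}/q\mathbb{Z})\times\Sigma$; writing $\pi_q:\mathbb{Z}\to\mathbb{Z}/q\mathbb{Z}$ for reduction mod $q$, an $\mathcal{S}$-Sudoku solution $F$ obeys $\mathcal{C}$ if for every $n\in\{0,\dots,N-1\}$ there is a permutation $\sigma_n$ of $\mathbb{Z}/q\mathbb{Z}$ with $(\sigma_n(\pi_q(m)),F(n,m))\in\mathcal{C}$ for all $m\in\mathbb{Z}$. The $(\mathcal{S},\mathcal{C})$-Sudoku puzzle is solvable if some $\mathcal{S}$-Sudoku solution obeys $\mathcal{C}$. *)

theory Defs
  imports
    Complex_Main
    "HOL-Library.FuncSet"
    "HOL-Library.Product_Plus"
    "HOL-Library.Nat_Bijection"
    "HOL-Combinatorics.Permutations"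
begin

section \<open>Domino problems\<close>

definition domino_set :: "'w set \<Rightarrow> ('w \<times> 'w) set \<Rightarrow> ('w \<times> 'w) set \<Rightarrow> bool" where
  "domino_set W R1 R2 \<longleftrightarrow> finite W \<and> W \<noteq> {} \<and> R1 \<subseteq> W \<times> W \<and> R2 \<subseteq> W \<times> W"

abbreviation e1 :: "int \<times> int" where "e1 \<equiv> (1, 0)"
abbreviation e2 :: "int \<times> int" where "e2 \<equiv> (0, 1)"

definition domino_function ::
  "'w set \<Rightarrow> ('w \<times> 'w) set \<Rightarrow> ('w \<times> 'w) set \<Rightarrow> (int \<times> int) set \<Rightarrow> (int \<times> int \<Rightarrow> 'w) \<Rightarrow> bool" where
  "domino_function W R1 R2 \<Omega> T \<longleftrightarrow>
     T \<in> \<Omega> \<rightarrow> W \<and>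
     (\<forall>s. s \<in> \<Omega> \<longrightarrow> s + e1 \<in> \<Omega> \<longrightarrow> (T s, T (s + e1)) \<in> R1) \<and>
     (\<forall>s. s \<in> \<Omega> \<longrightarrow> s + e2 \<in> \<Omega> \<longrightarrow> (T s, T (s + e2)) \<in> R2)"

definition domino_solvable ::
  "'w set \<Rightarrow> ('w \<times> 'w) set \<Rightarrow> ('w \<times> 'w) set \<Rightarrow> (int \<times> int) set \<Rightarrow> bool" where
  "domino_solvable W R1 R2 \<Omega> \<longleftrightarrow> (\<exists>T. domino_function W R1 R2 \<Omega> T)"

definition quadrant :: "(int \<times> int) set" where
  "quadrant = {0..} \<times> {0..}"

section \<open>Sudoku puzzles\<close>

text \<open>The functions in a rule are made extensional: they take the value \<^term>\<open>undefined\<close>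
  outside \<open>{0, \<dots>, N - 1}\<close>, so that equality in \<open>S\<close> is equality on \<open>{0, \<dots>, N - 1}\<close>.\<close>

definition sudoku_rule :: "nat \<Rightarrow> 'd set \<Rightarrow> (nat \<Rightarrow> 'd) set \<Rightarrow> bool" where
  "sudoku_rule N D S \<longleftrightarrow> finite D \<and> D \<noteq> {} \<and> S \<subseteq> {0..<N} \<rightarrow>\<^sub>E D"

definition board :: "nat \<Rightarrow> (nat \<times> int) set" where
  "board N = {0..<N} \<times> UNIV"

definition sudoku_solution ::
  "nat \<Rightarrow> 'd set \<Rightarrow> (nat \<Rightarrow> 'd) set \<Rightarrow> (nat \<times> int \<Rightarrow> 'd) \<Rightarrow> bool" where
  "sudoku_solution N D S F \<longleftrightarrow>
     F \<in> board N \<rightarrow> D \<and>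
     (\<forall>j i :: int. (\<lambda>n\<in>{0..<N}. F (n, j * int n + i)) \<in> S)"

text \<open>\<open>\<int>/q\<int>\<close> is represented by the residues \<open>{0, \<dots>, q - 1}\<close>; for \<open>q \<ge> 1\<close> the function
  \<open>residue q\<close> is the reduction map onto it.\<close>

definition residue :: "nat \<Rightarrow> int \<Rightarrow> nat" where
  "residue q m = nat (m mod int q)"

definition initial_condition :: "nat \<Rightarrow> 'd set \<Rightarrow> (nat \<times> 'd) set \<Rightarrow> bool" where
  "initial_condition q D C \<longleftrightarrow> q \<ge> 1 \<and> C \<subseteq> {0..<q} \<times> D"

definition obeys :: "nat \<Rightarrow> nat \<Rightarrow> (nat \<times> 'd) set \<Rightarrow> (nat \<times> int \<Rightarrow> 'd) \<Rightarrow> bool" where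
  "obeys N q C F \<longleftrightarrow>
     (\<forall>n\<in>{0..<N}. \<exists>\<sigma>. \<sigma> permutes {0..<q} \<and> (\<forall>m. (\<sigma> (residue q m), F (n, m)) \<in> C))"

definition sudoku_solvable ::
  "nat \<Rightarrow> 'd set \<Rightarrow> (nat \<Rightarrow> 'd) set \<Rightarrow> nat \<Rightarrow> (nat \<times> 'd) set \<Rightarrow> bool" where
  "sudoku_solvable N D S q C \<longleftrightarrow> (\<exists>F. sudoku_solution N D S F \<and> obeys N q C F)"

section \<open>Algorithms\<close>

text \<open>Algorithms are the partial recursive (\<open>\<mu>\<close>-recursive) functions. \<open>evaluates f xs y\<close> says that
  the program \<open>f\<close> halts on the arguments \<open>xs\<close> with output \<open>y\<close>; a program that does not halt is
  related to no output. \<open>Zero\<close> and \<open>Proj i\<close> accept argument lists of any (sufficient) length.\<close>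

datatype recf =
    Zero
  | Succ
  | Proj nat
  | Comp recf "recf list"
  | PrimRec recf recf
  | Minimize recf

inductive evaluates :: "recf \<Rightarrow> nat list \<Rightarrow> nat \<Rightarrow> bool" where
  zero: "evaluates Zero xs 0"
| succ: "evaluates Succ [x] (Suc x)"
| proj: "i < length xs \<Longrightarrow> evaluates (Proj i) xs (xs ! i)"
| comp: "length ys = length gs \<Longrightarrow> (\<forall>i<length gs. evaluates (gs ! i) xs (ys ! i)) \<Longrightarrow>
    evaluates f ys z \<Longrightarrow> evaluates (Comp f gs) xs z"
| primrec_0: "evaluates f xs y \<Longrightarrow> evaluates (PrimRec f g) (0 # xs) y"
| primrec_Suc: "evaluates (PrimRec f g) (n # xs) r \<Longrightarrow> evaluates g (n # r # xs) y \<Longrightarrow>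
    evaluates (PrimRec f g) (Suc n # xs) y"
| minimize: "evaluates f (n # xs) 0 \<Longrightarrow> (\<forall>k<n. \<exists>y. y > 0 \<and> evaluates f (k # xs) y) \<Longrightarrow>
    evaluates (Minimize f) xs n"

inductive_cases evaluates_ZeroE: "evaluates Zero xs y"
inductive_cases evaluates_SuccE: "evaluates Succ xs y"
inductive_cases evaluates_ProjE: "evaluates (Proj i) xs y"
inductive_cases evaluates_CompE: "evaluates (Comp f gs) xs y"
inductive_cases evaluates_PrimRec_0E: "evaluates (PrimRec f g) (0 # xs) y"
inductive_cases evaluates_PrimRec_SucE: "evaluates (PrimRec f g) (Suc n # xs) y"
inductive_cases evaluates_MinimizeE: "evaluates (Minimize f) xs y"

lemma evaluates_deterministic:
  "evaluates f xs y \<Longrightarrow> evaluates f xs z \<Longrightarrow> y = z"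
proof (induction arbitrary: z rule: evaluates.induct)
  case (comp ys gs xs f w)
  from comp.prems obtain vs where vs: "length vs = length gs"
      "\<forall>i<length gs. evaluates (gs ! i) xs (vs ! i)" "evaluates f vs z"
    by (auto elim: evaluates_CompE)
  have "ys = vs"
    using comp vs by (intro nth_equalityI) auto
  then show ?case using comp vs by auto
next
  case (minimize f n xs)
  from minimize.prems have z: "evaluates f (z # xs) 0"
      "\<forall>k<z. \<exists>y. y > 0 \<and> evaluates f (k # xs) y"
    by (auto elim: evaluates_MinimizeE)
  have "\<not> n < z" using z(2) minimize.IH(1) by force
  moreover have "\<not> z < n" using z(1) minimize.IH by force
  ultimately show ?case by simp
next
  case (primrec_Suc f g n xs r y)
  from primrec_Suc.prems obtain r' where "evaluates (PrimRec f g) (n # xs) r'"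
      "evaluates g (n # r' # xs) z"
    by (auto elim: evaluates_PrimRec_SucE)
  then show ?case using primrec_Suc.IH by auto
next
  case (zero xs)
  then show ?case by (rule evaluates_ZeroE) simp
next
  case (succ x)
  then show ?case by (rule evaluates_SuccE) simp
next
  case (proj i xs)
  from proj.prems show ?case by (rule evaluates_ProjE) simp
next
  case (primrec_0 f xs y g)
  from primrec_0.prems have "evaluates f xs z" by (rule evaluates_PrimRec_0E)
  then show ?case by (rule primrec_0.IH)
qed

section \<open>Encoding of the finite data\<close>

text \<open>Tiles and digits are taken to be natural numbers. A function \<open>g\<close> on \<open>{0, \<dots>, N - 1}\<close> is
  coded by its list of values. \<^const>\<open>set_encode\<close> is injective only on finite sets; the lemmas
  below show that the codes determine the objects they code.\<close>

definition relation_code :: "(nat \<times> nat) set \<Rightarrow> nat" where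
  "relation_code R = set_encode (prod_encode ` R)"

definition rule_code :: "nat \<Rightarrow> (nat \<Rightarrow> nat) set \<Rightarrow> nat" where
  "rule_code N S = set_encode ((\<lambda>g. list_encode (map g [0..<N])) ` S)"

definition domino_code :: "nat set \<Rightarrow> (nat \<times> nat) set \<Rightarrow> (nat \<times> nat) set \<Rightarrow> nat" where
  "domino_code W R1 R2 = list_encode [set_encode W, relation_code R1, relation_code R2]"

definition puzzle_code ::
  "nat \<Rightarrow> nat set \<Rightarrow> (nat \<Rightarrow> nat) set \<Rightarrow> nat \<Rightarrow> (nat \<times> nat) set \<Rightarrow> nat" where
  "puzzle_code N D S q C =
     list_encode [N, set_encode D, rule_code N S, q, relation_code C]"

lemma relation_code_eq_iff:
  "finite R \<Longrightarrow> finite R' \<Longrightarrow> relation_code R = relation_code R' \<longleftrightarrow> R = R'"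
  by (simp add: relation_code_def set_encode_eq inj_image_eq_iff inj_prod_encode)

lemma rule_code_eq_iff:
  assumes "sudoku_rule N D S" "sudoku_rule N D S'"
  shows "rule_code N S = rule_code N S' \<longleftrightarrow> S = S'"
proof -
  let ?c = "\<lambda>g. list_encode (map g [0..<N])" and ?E = "{0..<N} \<rightarrow>\<^sub>E D"
  have S: "S \<subseteq> ?E" "S' \<subseteq> ?E" and "finite ?E"
    using assms by (auto simp: sudoku_rule_def intro: finite_PiE)
  then have fin: "finite (?c ` S)" "finite (?c ` S')"
    by (auto dest: finite_subset)
  have "inj_on ?c ?E"
  proof (rule inj_onI)
    fix g h assume g: "g \<in> ?E" and h: "h \<in> ?E" and "?c g = ?c h"
    then have "\<forall>n<N. g n = h n" by (simp add: list_encode_eq)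
    then show "g = h" by (intro PiE_ext[OF g h]) auto
  qed
  then show ?thesis
    using S by (simp add: rule_code_def set_encode_eq[OF fin] inj_on_image_eq_iff)
qed

lemma domino_code_eq_iff:
  assumes "domino_set W R1 R2" "domino_set W' R1' R2'"
  shows "domino_code W R1 R2 = domino_code W' R1' R2' \<longleftrightarrow> W = W' \<and> R1 = R1' \<and> R2 = R2'"
proof -
  have "finite W" "finite W'" "finite R1" "finite R2" "finite R1'" "finite R2'"
    using assms by (auto simp: domino_set_def dest: finite_subset)
  then show ?thesis
    by (simp add: domino_code_def list_encode_eq set_encode_eq relation_code_eq_iff
        del: list_encode.simps)
qed

lemma puzzle_code_eq_iff:
  assumes "sudoku_rule N D S" "initial_condition q D C"
      and "sudoku_rule N' D' S'" "initial_condition q' D' C'"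
  shows "puzzle_code N D S q C = puzzle_code N' D' S' q' C' \<longleftrightarrow>
    N = N' \<and> D = D' \<and> S = S' \<and> q = q' \<and> C = C'"
proof -
  have "finite D" "finite D'" "finite C" "finite C'"
    using assms by (auto simp: sudoku_rule_def initial_condition_def dest: finite_subset)
  then show ?thesis
    using assms rule_code_eq_iff[of N D S S']
    by (auto simp: puzzle_code_def list_encode_eq set_encode_eq relation_code_eq_iff
        simp del: list_encode.simps)
qed

end

theory Submission
  imports Defs "HOL-Number_Theory.Cong"
begin

text \<open>Write \<open>v\<^sub>p x\<close> for the \<open>p\<close>-adic valuation of \<open>x\<close>. A tiling \<open>T\<close> of the quadrant is written into
  the cell \<open>(n, m)\<close> as \<open>T (v\<^sub>1\<^sub>1 x) (v\<^sub>1\<^sub>3 x)\<close> with \<open>x = 2 m + 1\<close>, together with \<open>x\<close> modulo 143 and the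
  last nonzero digits of \<open>x\<close> in base 11 and in base 13. Along a line \<open>x\<close> is an affine function of
  \<open>n\<close>, so the rule can ask for the digits of an affine function and for the matching of the tiles at
  the two lowest valuations that occur.

  Conversely, the initial condition makes the residues modulo 143 a nonconstant function on each
  column, and the rule then forces them to be a linear form \<open>c m + e n + d\<close> with \<open>c\<close> invertible. Where
  this form is divisible by \<open>p\<close>, the cells form a sublattice of the same shape as the board; lines of
  invertible slope, on which the digits at the two lowest valuations are tied together, and lines of
  the sublattice itself show that the digits on it again come from a linear form with the same \<open>c\<close>.
  By induction there are sublattices for all powers \<open>11\<^sup>i 13\<^sup>j\<close>, and their tiles give a tiling of
  the quadrant. The puzzle depends on the domino set through bounded quantifiers only, so its code is
  a primitive recursive function of the code of the domino set.\<close>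

section \<open>Recursive functions\<close>

definition computable :: "(nat \<Rightarrow> nat) \<Rightarrow> bool" where
  "computable f \<longleftrightarrow> (\<exists>r. \<forall>x. evaluates r [x] (f x))"

definition computable2 :: "(nat \<Rightarrow> nat \<Rightarrow> nat) \<Rightarrow> bool" where
  "computable2 f \<longleftrightarrow> (\<exists>r. \<forall>x y. evaluates r [x, y] (f x y))"

definition decidable :: "(nat \<Rightarrow> bool) \<Rightarrow> bool" where
  "decidable P \<longleftrightarrow> computable (\<lambda>x. of_bool (P x))"

section \<open>Programs for arithmetic\<close>

lemma evaluates_Comp1:
  "evaluates g xs y \<Longrightarrow> evaluates f [y] z \<Longrightarrow> evaluates (Comp f [g]) xs z"
  by (rule evaluates.comp[of "[y]"]) auto

lemma evaluates_Comp2: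
  "evaluates g xs y \<Longrightarrow> evaluates h xs y' \<Longrightarrow> evaluates f [y, y'] z \<Longrightarrow>
   evaluates (Comp f [g, h]) xs z"
  by (rule evaluates.comp[of "[y, y']"]) (auto simp: less_Suc_eq)

lemma evaluates_Proj: "i < length xs \<Longrightarrow> y = xs ! i \<Longrightarrow> evaluates (Proj i) xs y"
  by (auto intro: evaluates.proj)

lemma evaluates_PrimRec:
  assumes "evaluates f xs (h 0)"
    and "\<And>n. evaluates g (n # h n # xs) (h (Suc n))"
  shows "evaluates (PrimRec f g) (n # xs) (h n)"
  by (induction n) (auto intro: assms evaluates.intros)

lemma computable_id: "computable (\<lambda>x. x)"
  unfolding computable_def by (intro exI[of _ "Proj 0"] allI evaluates_Proj) auto

lemma computable_comp:
  assumes "computable f" "computable g"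
  shows "computable (\<lambda>x. f (g x))"
  using assms unfolding computable_def by (meson evaluates_Comp1)

lemma computable2_comp:
  assumes "computable2 h" "computable f" "computable g"
  shows "computable (\<lambda>x. h (f x) (g x))"
  using assms unfolding computable_def computable2_def by (meson evaluates_Comp2)

lemma computable_Suc: "computable f \<Longrightarrow> computable (\<lambda>x. Suc (f x))"
  by (rule computable_comp[of Suc]) (auto simp: computable_def intro: evaluates.succ)

lemma computable_const: "computable (\<lambda>x. k)"
proof (induction k)
  case 0
  show ?case unfolding computable_def using evaluates.zero by blast
qed (rule computable_Suc)

lemma computable_primrec:
  assumes "computable s" "computable b" "computable2 g"
    and "\<And>x. h x 0 = s x" "\<And>x n. h x (Suc n) = g x (h x n)"
  shows "computable (\<lambda>x. h x (b x))"
proof -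
  obtain rs rb rg where r: "\<And>x. evaluates rs [x] (s x)" "\<And>x. evaluates rb [x] (b x)"
      "\<And>x y. evaluates rg [x, y] (g x y)"
    using assms unfolding computable_def computable2_def by metis
  \<comment> \<open>The step program receives the counter, the previous value and \<open>x\<close>
    in this order, so \<open>Proj 2\<close> and \<open>Proj 1\<close> hand \<open>x\<close> and the
    previous value to \<open>g\<close>.\<close>
  have "evaluates (PrimRec rs (Comp rg [Proj 2, Proj 1])) (n # [x]) (h x n)" for x n
    by (rule evaluates_PrimRec)
       (auto simp: assms(4,5) intro!: r evaluates_Comp2 evaluates_Proj)
  then have "evaluates (Comp (PrimRec rs (Comp rg [Proj 2, Proj 1])) [rb, Proj 0]) [x] (h x (b x))" for x
    by (intro evaluates_Comp2[OF r(2)] evaluates_Proj) auto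
  then show ?thesis unfolding computable_def by blast
qed

lemma computable2_add: "computable2 (+)"
proof -
  have "evaluates (PrimRec (Proj 0) (Comp Succ [Proj 1])) (n # [x]) (n + x)" for n x
    by (rule evaluates_PrimRec) (auto intro!: evaluates_Comp1 evaluates_Proj evaluates.succ)
  then show ?thesis unfolding computable2_def by blast
qed

lemma computable2_mult: "computable2 (*)"
proof -
  obtain r where r: "\<And>x y. evaluates r [x, y] (x + y)"
    using computable2_add unfolding computable2_def by blast
  have "evaluates (PrimRec Zero (Comp r [Proj 2, Proj 1])) (n # [x]) (n * x)" for n x
    by (rule evaluates_PrimRec) (auto intro!: evaluates_Comp2 evaluates_Proj evaluates.zero r)
  then show ?thesis unfolding computable2_def by blast
qed

lemma computable2_diff: "computable2 (-)"
proof -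
  \<comment> \<open>Predecessor: the recursion returns its own counter. Iterated \<open>n\<close>
    times from \<open>x\<close> it gives truncated subtraction; the recursion runs on the first
    argument, so the arguments are swapped at the end.\<close>
  let ?p = "PrimRec Zero (Proj 0)"
  have "evaluates ?p (n # []) (n - 1)" for n
    by (rule evaluates_PrimRec) (auto intro!: evaluates.zero evaluates_Proj)
  then have "evaluates ?p [x - n] (x - Suc n)" for n x
    by (metis Suc_eq_plus1 diff_diff_left)
  then have "evaluates (Comp ?p [Proj 1]) [n, x - n, x] (x - Suc n)" for n x
    by (rule evaluates_Comp1[OF evaluates_Proj, rotated 2]) simp_all
  then have "evaluates (PrimRec (Proj 0) (Comp ?p [Proj 1])) (n # [x]) (x - n)" for n x
    by (intro evaluates_PrimRec evaluates_Proj) simp_all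
  then have "evaluates (Comp (PrimRec (Proj 0) (Comp ?p [Proj 1])) [Proj 1, Proj 0]) [x, n] (x - n)"
    for n x
    by (rule evaluates_Comp2[OF evaluates_Proj evaluates_Proj, rotated 4]) simp_all
  then show ?thesis unfolding computable2_def by blast
qed

lemmas computable_add = computable2_comp[OF computable2_add]
lemmas computable_mult = computable2_comp[OF computable2_mult]
lemmas computable_diff = computable2_comp[OF computable2_diff]

section \<open>Decidable predicates\<close>

lemma decidable_le: "computable f \<Longrightarrow> computable g \<Longrightarrow> decidable (\<lambda>x. f x \<le> g x)"
proof -
  assume "computable f" "computable g"
  moreover have "of_bool (f x \<le> g x) = 1 - (f x - g x)" for x
    by auto
  ultimately show ?thesis
    unfolding decidable_def by (auto intro!: computable_diff computable_const)
qed

lemma decidable_less: "computable f \<Longrightarrow> computable g \<Longrightarrow> decidable (\<lambda>x. f x < g x)"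
  unfolding less_eq_Suc_le by (intro decidable_le computable_Suc)

lemma decidable_const: "decidable (\<lambda>x. P)"
  unfolding decidable_def by (rule computable_const)

lemma decidable_not: "decidable P \<Longrightarrow> decidable (\<lambda>x. \<not> P x)"
proof -
  have "of_bool (\<not> P x) = (1 :: nat) - of_bool (P x)" for x
    by auto
  then show "decidable P \<Longrightarrow> ?thesis"
    unfolding decidable_def by (auto intro!: computable_diff computable_const)
qed

lemma decidable_conj: "decidable P \<Longrightarrow> decidable Q \<Longrightarrow> decidable (\<lambda>x. P x \<and> Q x)"
  unfolding decidable_def of_bool_conj by (rule computable_mult)

lemma decidable_disj: "decidable P \<Longrightarrow> decidable Q \<Longrightarrow> decidable (\<lambda>x. P x \<or> Q x)"
  using decidable_not[OF decidable_conj[OF decidable_not[of P] decidable_not[of Q]]]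
  by (simp only: de_Morgan_conj not_not simp_thms)

lemma decidable_imp: "decidable P \<Longrightarrow> decidable Q \<Longrightarrow> decidable (\<lambda>x. P x \<longrightarrow> Q x)"
  unfolding imp_conv_disj by (intro decidable_disj decidable_not)

lemma decidable_eq: "computable f \<Longrightarrow> computable g \<Longrightarrow> decidable (\<lambda>x. f x = g x)"
  unfolding order_eq_iff[where ?'a = nat] by (intro decidable_conj decidable_le)

section \<open>Coded pairs and their projections\<close>

lemma computable_triangle: "computable f \<Longrightarrow> computable (\<lambda>x. triangle (f x))"
proof (rule computable_comp[of triangle])
  obtain r where r: "\<And>x y. evaluates r [x, y] (x + y)"
    using computable2_add unfolding computable2_def by blast
  have "evaluates (PrimRec Zero (Comp r [Proj 1, Comp Succ [Proj 0]])) (n # []) (triangle n)" for n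
    by (rule evaluates_PrimRec)
       (auto intro!: evaluates_Comp2 evaluates_Comp1 evaluates_Proj evaluates.zero evaluates.succ
          simp: r simp flip: add_Suc_right)
  then show "computable triangle" unfolding computable_def by blast
qed

lemma computable_prod_encode:
  "computable f \<Longrightarrow> computable g \<Longrightarrow> computable (\<lambda>x. prod_encode (f x, g x))"
  unfolding prod_encode_def prod.case by (intro computable_add computable_triangle)

text \<open>Coded pairs serve as environments: a variable bound by a sum, quantifier or iteration is the
  second component, and the variables already in scope are in the first.\<close>

definition pfst :: "nat \<Rightarrow> nat" where "pfst z = fst (prod_decode z)"
definition psnd :: "nat \<Rightarrow> nat" where "psnd z = snd (prod_decode z)"

lemma pfst_prod_encode [simp]: "pfst (prod_encode (a, b)) = a"
  and psnd_prod_encode [simp]: "psnd (prod_encode (a, b)) = b"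
  and prod_encode_pfst_psnd [simp]: "prod_encode (pfst z, psnd z) = z"
  by (simp_all add: pfst_def psnd_def)

lemma psnd_0 [simp]: "psnd 0 = 0"
  by (simp add: psnd_def prod_decode_def prod_decode_aux.simps)

lemma triangle_mono: "a \<le> b \<Longrightarrow> triangle a \<le> triangle b"
  by (rule lift_Suc_mono_le[of triangle]) auto

lemma triangle_pfst_psnd: "triangle (pfst z + psnd z) + pfst z = z"
  using prod_encode_pfst_psnd[of z] by (simp only: prod_encode_def prod.case)

text \<open>The largest \<open>s\<close> with \<open>triangle s \<le> z\<close>, written as a count.
  For \<open>z = triangle (a + b) + a\<close> it is \<open>a + b\<close>, from which both components
  of the pair coded by \<open>z\<close> are found by subtraction.\<close>

definition triangle_root :: "nat \<Rightarrow> nat" where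
  "triangle_root z = (\<Sum>k<z. of_bool (triangle (Suc k) \<le> z))"

lemma triangle_root: "triangle_root z = pfst z + psnd z"
proof -
  define a b where ab: "a = pfst z" "b = psnd z"
  have z: "z = triangle (a + b) + a"
    by (simp add: ab triangle_pfst_psnd)
  have "triangle (Suc k) \<le> z \<longleftrightarrow> k < a + b" for k
  proof
    show "k < a + b" if "triangle (Suc k) \<le> z"
    proof (rule ccontr)
      assume "\<not> k < a + b"
      then have "triangle (Suc (a + b)) \<le> triangle (Suc k)"
        by (intro triangle_mono) simp
      with that z show False by (simp del: mult_Suc)
    qed
    show "triangle (Suc k) \<le> z" if "k < a + b"
      using triangle_mono[of "Suc k" "a + b"] that z by simp
  qed
  moreover have "a + b \<le> z"
  proof -
    \<comment> \<open>The sum only runs over \<open>k < z\<close>; this bound shows that no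
      \<open>k\<close> is cut off.\<close>
    have "n \<le> triangle n" for n by (induction n) auto
    then show ?thesis unfolding z by (rule trans_le_add1)
  qed
  ultimately have "triangle_root z = card ({..<z} \<inter> {k. k < a + b})"
    by (simp add: triangle_root_def)
  also have "{..<z} \<inter> {k. k < a + b} = {..<a + b}"
    using \<open>a + b \<le> z\<close> by auto
  finally show ?thesis by (simp add: ab)
qed

lemma pfst_eq: "pfst z = z - triangle (triangle_root z)"
  and psnd_eq: "psnd z = triangle_root z - pfst z"
proof -
  show "pfst z = z - triangle (triangle_root z)"
    using triangle_pfst_psnd[of z] by (simp add: triangle_root)
  show "psnd z = triangle_root z - pfst z"
    by (simp add: triangle_root)
qed

text \<open>The recursion is written out by hand, since the general rule for bounded sums keeps its
  state in a coded pair and so relies on the projections.\<close>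

lemma computable_triangle_root: "computable triangle_root"
proof -
  obtain t where t: "\<And>x. evaluates t [x] (triangle x)"
    using computable_triangle[OF computable_id] unfolding computable_def by blast
  obtain d where d: "\<And>x y. evaluates d [x, y] (x - y)"
    using computable2_diff unfolding computable2_def by blast
  obtain s where s: "\<And>x y. evaluates s [x, y] (x + y)"
    using computable2_add unfolding computable2_def by blast
  define st where "st = Comp d [Comp t [Comp Succ [Proj 0]], Proj 2]"
  \<comment> \<open>Adds \<open>1 - (triangle (Suc n) - z)\<close>, which is the truth value of
    \<open>triangle (Suc n) \<le> z\<close>; \<open>Comp (Comp Succ [Zero]) [Proj 0]\<close> is the
    constant 1.\<close>
  define g where "g = Comp s [Proj 1, Comp d [Comp (Comp Succ [Zero]) [Proj 0], st]]"
  let ?h = "\<lambda>z n. \<Sum>k<n. of_bool (triangle (Suc k) \<le> z) :: nat"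
  have "evaluates g (n # r # [z]) (r + (1 - (triangle (Suc n) - z)))" for n r z
    unfolding g_def st_def One_nat_def
    by (rule evaluates_Comp2[OF evaluates_Proj evaluates_Comp2[OF evaluates_Comp1[OF evaluates_Proj
           evaluates_Comp1[OF evaluates.zero evaluates.succ]]
         evaluates_Comp2[OF evaluates_Comp1[OF evaluates_Comp1[OF evaluates_Proj evaluates.succ] t]
           evaluates_Proj d] d] s])
       simp_all
  moreover have "r + (1 - (triangle (Suc n) - z)) = r + of_bool (triangle (Suc n) \<le> z)" for n r z
    by simp
  ultimately have "evaluates (PrimRec Zero g) (n # [z]) (?h z n)" for n z
    by (intro evaluates_PrimRec) (auto intro: evaluates.zero simp del: triangle_Suc)
  then have "evaluates (Comp (PrimRec Zero g) [Proj 0, Proj 0]) [z] (triangle_root z)" for z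
    unfolding triangle_root_def
    by (rule evaluates_Comp2[OF evaluates_Proj evaluates_Proj, rotated 4]) simp_all
  then show ?thesis unfolding computable_def by blast
qed

lemma computable_pfst: "computable f \<Longrightarrow> computable (\<lambda>x. pfst (f x))"
  by (rule computable_comp[of pfst], subst pfst_eq[abs_def])
     (intro computable_diff computable_triangle computable_triangle_root computable_id)

lemma computable_psnd: "computable f \<Longrightarrow> computable (\<lambda>x. psnd (f x))"
  by (rule computable_comp[of psnd], subst psnd_eq[abs_def])
     (intro computable_diff computable_pfst computable_triangle_root computable_id)

text \<open>The program forms the code of the pair first. Thus the closure rules for unary functions
  also reach functions of an environment and a bound variable.\<close>

lemma computable2_paired:
  assumes "computable (\<lambda>z. g (pfst z) (psnd z))"
  shows "computable2 g"
proof -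
  obtain rp where rp: "\<And>z. evaluates rp [z] (g (pfst z) (psnd z))"
    using assms unfolding computable_def by blast
  obtain t where t: "\<And>x. evaluates t [x] (triangle x)"
    using computable_triangle[OF computable_id] unfolding computable_def by blast
  obtain s where s: "\<And>x y. evaluates s [x, y] (x + y)"
    using computable2_add unfolding computable2_def by blast
  have "evaluates (Comp s [Comp t [s], Proj 0]) [x, y] (prod_encode (x, y))" for x y
    unfolding prod_encode_def prod.case
    by (rule evaluates_Comp2[OF evaluates_Comp1[OF s t] evaluates_Proj s]) simp_all
  then have "evaluates (Comp rp [Comp s [Comp t [s], Proj 0]]) [x, y] (g x y)" for x y
    using evaluates_Comp1[OF _ rp] by fastforce
  then show ?thesis unfolding computable2_def by blast
qed

section \<open>Iteration, bounded sums and bounded quantifiers\<close>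

lemma computable_funpow:
  assumes "computable (\<lambda>z. g (pfst z) (psnd z))" "computable b" "computable s"
  shows "computable (\<lambda>x. (g x ^^ b x) (s x))"
  by (rule computable_primrec[OF assms(3,2) computable2_paired[OF assms(1)]]) simp_all

lemma computable_sum:
  assumes "computable b" "computable (\<lambda>z. h (pfst z) (psnd z))"
  shows "computable (\<lambda>x. \<Sum>y<b x. h x y)"
proof -
  \<comment> \<open>An iterated step does not see its counter, so the state is the pair of the
    counter and the partial sum.\<close>
  define g where "g = (\<lambda>x w. prod_encode (Suc (pfst w), psnd w + h x (pfst w)))"
  have "computable2 (\<lambda>x y. h x y)"
    by (rule computable2_paired) (rule assms(2))
  then have "computable (\<lambda>z. g (pfst z) (psnd z))"
    unfolding g_def
    by (intro computable_prod_encode computable_Suc computable_add computable_pfst computable_psnd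
        computable_id computable2_comp[of h])
  then have "computable (\<lambda>x. psnd ((g x ^^ b x) (prod_encode (0, 0))))"
    by (intro computable_psnd computable_funpow assms computable_const)
  moreover have "(g x ^^ n) (prod_encode (0, 0)) = prod_encode (n, \<Sum>y<n. h x y)" for x n
    by (induction n) (simp_all add: g_def)
  ultimately show ?thesis by simp
qed

lemma decidable_ex:
  assumes "computable b" "decidable (\<lambda>z. P (pfst z) (psnd z))"
  shows "decidable (\<lambda>x. \<exists>y<b x. P x y)"
proof -
  have "(\<exists>y<b x. P x y) \<longleftrightarrow> 0 < (\<Sum>y<b x. of_bool (P x y) :: nat)" for x
    by (auto simp: card_gt_0_iff)
  moreover have "decidable (\<lambda>x. 0 < (\<Sum>y<b x. of_bool (P x y) :: nat))"
    by (intro decidable_less computable_const computable_sum assms(1) assms(2)[unfolded decidable_def])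
  ultimately show ?thesis by simp
qed

lemma decidable_all:
  assumes "computable b" "decidable (\<lambda>z. P (pfst z) (psnd z))"
  shows "decidable (\<lambda>x. \<forall>y<b x. P x y)"
  using decidable_not[OF decidable_ex[OF assms(1) decidable_not[OF assms(2)]]] by simp

lemma computable_power: "computable f \<Longrightarrow> computable (\<lambda>x. k ^ f x)"
proof -
  assume "computable f"
  then have "computable (\<lambda>x. (((*) k) ^^ f x) 1)"
    by (intro computable_funpow computable_mult computable_psnd computable_id computable_const)
  moreover have "(((*) k) ^^ n) 1 = k ^ n" for n
    by (induction n) auto
  ultimately show ?thesis by simp
qed

lemma computable_div:
  assumes "computable f" "computable g"
  shows "computable (\<lambda>x. f x div g x)"
proof -
  \<comment> \<open>The quotient counts the positive multiples of \<open>b\<close> up to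
    \<open>a\<close>; the conjunct \<open>0 < b\<close> yields 0 for \<open>b = 0\<close>, in
    agreement with \<open>div\<close>.\<close>
  have "a div b = (\<Sum>k<a. of_bool (Suc k * b \<le> a \<and> 0 < b))" for a b :: nat
  proof (cases "b = 0")
    case False
    then have "Suc k * b \<le> a \<longleftrightarrow> k < a div b" for k
      by (metis less_eq_Suc_le less_eq_div_iff_mult_less_eq neq0_conv)
    moreover have "a div b \<le> a" by simp
    ultimately have "{..<a} \<inter> {k. Suc k * b \<le> a} = {..<a div b}"
      by (intro set_eqI) (simp only: Int_iff lessThan_iff mem_Collect_eq, linarith)
    then have "(\<Sum>k<a. of_bool (Suc k * b \<le> a \<and> 0 < b)) = card {..<a div b}"
      using False by (simp del: mult_Suc)
    then show ?thesis by simp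
  qed simp
  moreover have "computable (\<lambda>x. \<Sum>k<f x. of_bool (Suc k * g x \<le> f x \<and> 0 < g x))"
    by (intro computable_sum assms(1))
       (intro decidable_le decidable_less decidable_conj[unfolded decidable_def]
          decidable_conj computable_mult computable_Suc computable_psnd computable_const
          computable_comp[OF assms(1)] computable_comp[OF assms(2)] computable_pfst computable_id
          decidable_le[unfolded decidable_def] decidable_less[unfolded decidable_def])
  ultimately show ?thesis by presburger
qed

lemma computable_mod:
  "computable f \<Longrightarrow> computable g \<Longrightarrow> computable (\<lambda>x. f x mod g x)"
  unfolding modulo_nat_def by (intro computable_diff computable_mult computable_div)

lemma decidable_mem_set_decode:
  assumes "computable f" "computable g"
  shows "decidable (\<lambda>x. f x \<in> set_decode (g x))"
proof -
  have "decidable (\<lambda>x. g x div 2 ^ f x mod 2 = 1)"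
    by (intro decidable_eq computable_mod computable_div computable_power computable_const assms)
  then show ?thesis by (simp add: set_decode_def odd_iff_mod_2_eq_one)
qed

lemma computable_set_encode:
  assumes "computable b" "decidable (\<lambda>z. P (pfst z) (psnd z))"
  shows "computable (\<lambda>x. set_encode {y. y < b x \<and> P x y})"
proof -
  have "computable (\<lambda>x. \<Sum>y<b x. of_bool (P x y) * 2 ^ y)"
    using assms(2) unfolding decidable_def
    by (intro computable_sum assms(1) computable_mult computable_power computable_psnd computable_id)
  moreover have "(\<Sum>y<b x. of_bool (P x y) * 2 ^ y) = set_encode {y. y < b x \<and> P x y}" for x
  proof -
    have "{y. y < b x \<and> P x y} = {y \<in> {..<b x}. P x y}" by auto
    then show ?thesis
      by (auto simp: set_encode_def sum.inter_filter intro!: sum.cong)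
  qed
  ultimately show ?thesis by simp
qed

lemmas computable_intros =
  computable_const computable_Suc computable_add computable_mult computable_diff computable_div
  computable_mod computable_power computable_prod_encode computable_set_encode
  decidable_le decidable_less decidable_eq decidable_not decidable_conj decidable_disj
  decidable_imp decidable_ex decidable_all decidable_mem_set_decode
  computable_pfst computable_psnd computable_funpow computable_id

section \<open>The puzzle of a domino set\<close>

definition code_tl :: "nat \<Rightarrow> nat" where "code_tl y = psnd (y - 1)"
definition code_nth :: "nat \<Rightarrow> nat \<Rightarrow> nat" where "code_nth y n = pfst ((code_tl ^^ n) y - 1)"

lemma funpow_code_tl: "(code_tl ^^ n) (list_encode xs) = list_encode (drop n xs)"
proof (induction n)
  case (Suc n)
  \<comment> \<open>For the empty list, truncated subtraction and \<open>psnd 0 = 0\<close> give 0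
    again.\<close>
  have "code_tl (list_encode ys) = list_encode (tl ys)" for ys
    by (cases ys) (simp_all add: code_tl_def)
  then show ?case by (simp add: Suc drop_Suc tl_drop)
qed simp

lemma list_encode_eq_0_iff: "list_encode xs = 0 \<longleftrightarrow> xs = []"
  by (cases xs) auto

lemma code_nth_list_encode: "n < length xs \<Longrightarrow> code_nth (list_encode xs) n = xs ! n"
  by (simp add: code_nth_def funpow_code_tl flip: Cons_nth_drop_Suc)

text \<open>The code of the list of \<open>n\<close> copies of \<open>K\<close>. Pairing is monotone
  in both components, so it bounds the codes of all lists of \<open>n\<close> numbers below
  \<open>K\<close>.\<close>

definition list_bound :: "nat \<Rightarrow> nat \<Rightarrow> nat" where
  "list_bound K n = ((\<lambda>b. Suc (prod_encode (K, b))) ^^ n) 0"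

lemma prod_encode_mono: "a \<le> a' \<Longrightarrow> b \<le> b' \<Longrightarrow> prod_encode (a, b) \<le> prod_encode (a', b')"
  unfolding prod_encode_def prod.case by (intro add_mono triangle_mono) auto

lemma list_encode_le_bound:
  "\<forall>x\<in>set xs. x < K \<Longrightarrow> list_encode xs \<le> list_bound K (length xs)"
  by (induction xs) (auto simp: list_bound_def intro!: prod_encode_mono)

text \<open>Makes a set of coded functions a bounded comprehension with computable conditions. The
  tails are nonzero before \<open>N\<close> and 0 at \<open>N\<close>, which fixes the length; by
  \<open>cong\<close>, \<open>P\<close> sees only the values below \<open>N\<close>, so
  \<open>code_nth y\<close> may stand in for the extensional function.\<close>

lemma list_code_image:
  assumes cong: "\<And>g h. (\<And>n. n < N \<Longrightarrow> g n = h n) \<Longrightarrow> P g = P h"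
  shows "(\<lambda>g. list_encode (map g [0..<N])) ` {g \<in> {0..<N} \<rightarrow>\<^sub>E {0..<K}. P g} =
    {y. y < Suc (list_bound K N) \<and> (code_tl ^^ N) y = 0 \<and>
        (\<forall>n<N. (code_tl ^^ n) y \<noteq> 0 \<and> code_nth y n < K) \<and> P (code_nth y)}" (is "?I = ?Y")
proof (intro equalityI subsetI)
  fix y assume "y \<in> ?I"
  then obtain g where g: "g \<in> {0..<N} \<rightarrow>\<^sub>E {0..<K}" "P g" and y: "y = list_encode (map g [0..<N])"
    by auto
  have "code_nth y n = g n" if "n < N" for n
    using that by (simp add: y code_nth_list_encode)
  moreover from this have "P (code_nth y)"
    using g(2) cong[of g "code_nth y"] by simp
  moreover have "g n < K" if "n < N" for n
    using g(1) that by (auto dest: PiE_mem)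
  moreover from this have "y \<le> list_bound K N"
    unfolding y using list_encode_le_bound[of "map g [0..<N]" K] by simp
  ultimately show "y \<in> ?Y"
    by (simp add: less_Suc_eq_le del: neq0_conv)
       (simp add: y funpow_code_tl list_encode_eq_0_iff del: neq0_conv)
next
  fix y assume "y \<in> ?Y"
  then have y: "(code_tl ^^ N) y = 0" "\<And>n. n < N \<Longrightarrow> (code_tl ^^ n) y \<noteq> 0"
      "\<And>n. n < N \<Longrightarrow> code_nth y n < K" "P (code_nth y)"
    by auto
  define xs where "xs = list_decode y"
  have yxs: "y = list_encode xs" by (simp add: xs_def)
  have "length xs \<le> N"
    using y(1) by (simp add: yxs funpow_code_tl list_encode_eq_0_iff)
  moreover have "\<not> length xs < N"
    using y(2)[of "length xs"] by (auto simp: yxs funpow_code_tl)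
  ultimately have len: "length xs = N" by simp
  define g where "g = restrict (code_nth y) {0..<N}"
  have "map g [0..<N] = xs"
    by (rule nth_equalityI) (simp_all add: len g_def yxs code_nth_list_encode)
  moreover have "P g"
    using y(4) cong[of g "code_nth y"] by (simp add: g_def)
  moreover have "g \<in> {0..<N} \<rightarrow>\<^sub>E {0..<K}"
    using y(3) by (auto simp: g_def)
  ultimately show "y \<in> ?I"
    unfolding yxs by blast
qed

text \<open>A digit \<open>d\<close> is read as \<open>d = l + 143 (u + 11 (v + 13 t))\<close> with \<open>l < 143\<close>, \<open>u < 11\<close>, \<open>v < 13\<close>:
  \<open>l\<close> is the value of a linear form modulo \<open>143 = 11 \<cdot> 13\<close>, \<open>u\<close> and \<open>v\<close> are its last nonzero digits
  in base 11 and 13, and \<open>t\<close> is a tile.\<close>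

definition digit11 :: "nat \<Rightarrow> nat" where "digit11 d = d div 143 mod 11"
definition digit13 :: "nat \<Rightarrow> nat" where "digit13 d = d div 1573 mod 13"
definition tile :: "nat \<Rightarrow> nat" where "tile d = d div 20449"

text \<open>On a line the linear form is \<open>p\<^sup>k (a n + b)\<close> with \<open>p\<close> not dividing both \<open>a\<close> and \<open>b\<close>. Where
  \<open>a n + b\<close> vanishes modulo \<open>p\<close> (and \<open>a\<close> does not), \<open>n\<close> has the form \<open>n\<^sub>0 + p (n div p)\<close> and
  \<open>(a n + b) / p = a (n div p) + c\<close>. So \<open>level0\<close> and \<open>level1\<close> detect the valuations \<open>k\<close> and
  \<open>k + 1\<close>.\<close>

definition level0 :: "nat \<Rightarrow> nat \<Rightarrow> nat \<Rightarrow> nat \<Rightarrow> bool" where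
  "level0 p a b n \<longleftrightarrow> (a * n + b) mod p \<noteq> 0"

definition level1 :: "nat \<Rightarrow> nat \<Rightarrow> nat \<Rightarrow> nat \<Rightarrow> nat \<Rightarrow> bool" where
  "level1 p a b c n \<longleftrightarrow> a \<noteq> 0 \<and> (a * n + b) mod p = 0 \<and> (a * (n div p) + c) mod p \<noteq> 0"

definition fits :: "nat \<Rightarrow> nat \<Rightarrow> nat \<Rightarrow> nat \<Rightarrow> nat \<Rightarrow> nat \<Rightarrow> bool" where
  "fits p a b c n u \<longleftrightarrow> (level0 p a b n \<longrightarrow> u = (a * n + b) mod p) \<and>
     (level1 p a b c n \<longrightarrow> u = (a * (n div p) + c) mod p)"

text \<open>With \<open>k\<close> and \<open>k'\<close> the least valuations for 11 and 13 on the
  line, \<open>s\<close>, \<open>s1\<close> and \<open>s2\<close> stand for the tiles at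
  \<open>(k, k')\<close>, \<open>(k + 1, k')\<close> and \<open>(k, k' + 1)\<close>.\<close>

definition tiles_fit ::
  "nat \<Rightarrow> nat \<Rightarrow> nat \<Rightarrow> nat \<Rightarrow> nat \<Rightarrow> nat \<Rightarrow> nat \<Rightarrow> nat \<Rightarrow> nat \<Rightarrow> nat \<Rightarrow> nat \<Rightarrow> bool" where
  "tiles_fit a b c a' b' c' s s1 s2 n t \<longleftrightarrow>
     (level0 11 a b n \<and> level0 13 a' b' n \<longrightarrow> t = s) \<and>
     (level1 11 a b c n \<and> level0 13 a' b' n \<longrightarrow> t = s1) \<and>
     (level0 11 a b n \<and> level1 13 a' b' c' n \<longrightarrow> t = s2)"

text \<open>All quantifiers are bounded, for decidability. The width 26 is twice 13, so for
  \<open>p = 11\<close> and for \<open>p = 13\<close> every column has another one at distance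
  \<open>p\<close>.\<close>

definition valid_line :: "nat \<Rightarrow> (nat \<times> nat) set \<Rightarrow> (nat \<times> nat) set \<Rightarrow> (nat \<Rightarrow> nat) \<Rightarrow> bool" where
  "valid_line M R1 R2 g \<longleftrightarrow>
     (\<exists>A<143. \<exists>B<143. \<forall>n<26. g n mod 143 = (A * n + B) mod 143) \<and>
     (\<forall>n<26. (g n mod 11 \<noteq> 0 \<longrightarrow> digit11 (g n) = g n mod 11) \<and>
             (g n mod 13 \<noteq> 0 \<longrightarrow> digit13 (g n) = g n mod 13)) \<and>
     (\<exists>a<11. \<exists>b<11. \<exists>c<11. \<exists>a'<13. \<exists>b'<13. \<exists>c'<13. \<exists>s<M. \<exists>s1<M. \<exists>s2<M.
        (a \<noteq> 0 \<or> b \<noteq> 0) \<and> (a' \<noteq> 0 \<or> b' \<noteq> 0) \<and> (s, s1) \<in> R1 \<and> (s, s2) \<in> R2 \<and>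
        (\<forall>n<26. fits 11 a b c n (digit11 (g n)) \<and> fits 13 a' b' c' n (digit13 (g n)) \<and>
          tiles_fit a b c a' b' c' s s1 s2 n (tile (g n))))"

definition puzzle_digits :: "nat \<Rightarrow> nat set" where
  "puzzle_digits M = {0..<20449 * M}"

definition puzzle_rule :: "nat \<Rightarrow> (nat \<times> nat) set \<Rightarrow> (nat \<times> nat) set \<Rightarrow> (nat \<Rightarrow> nat) set" where
  "puzzle_rule M R1 R2 = {g \<in> {0..<26} \<rightarrow>\<^sub>E puzzle_digits M. valid_line M R1 R2 g}"

text \<open>Obeying this condition means that in each column the residues of the entries modulo 143
  arise from those of the heights by a permutation.\<close>

definition puzzle_init :: "nat \<Rightarrow> (nat \<times> nat) set" where
  "puzzle_init M = {(r, d). r < 143 \<and> d \<in> puzzle_digits M \<and> d mod 143 = r}"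

lemma valid_line_cong:
  "(\<And>n. n < 26 \<Longrightarrow> g n = h n) \<Longrightarrow> valid_line M R1 R2 g = valid_line M R1 R2 h"
  unfolding valid_line_def by simp

definition relation_decode :: "nat \<Rightarrow> (nat \<times> nat) set" where
  "relation_decode r = {e. prod_encode e \<in> set_decode r}"

lemma relation_decode_code: "finite R \<Longrightarrow> relation_decode (relation_code R) = R"
  by (simp add: relation_decode_def relation_code_def inj_image_mem_iff[OF inj_prod_encode])

definition puzzle_code_of :: "nat \<Rightarrow> nat" where
  "puzzle_code_of z =
    (let M = code_nth z 0; R1 = relation_decode (code_nth z 1); R2 = relation_decode (code_nth z 2)
     in puzzle_code 26 (puzzle_digits M) (puzzle_rule M R1 R2) 143 (puzzle_init M))"

section \<open>Computability of the puzzle\<close>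

lemma decidable_valid_line:
  assumes "computable M" "computable r1" "computable r2" "computable2 g"
  shows "decidable (\<lambda>x. valid_line (M x) (relation_decode (r1 x)) (relation_decode (r2 x)) (g x))"
proof -
  note comp = computable_comp[OF assms(1)] computable_comp[OF assms(2)] computable_comp[OF assms(3)]
    computable2_comp[OF assms(4)]
  show ?thesis
    unfolding valid_line_def fits_def tiles_fit_def level0_def level1_def digit11_def digit13_def
      tile_def relation_decode_def mem_Collect_eq
    by (intro computable_intros assms(1-3) comp)
qed

lemma computable_code_nth: "computable f \<Longrightarrow> computable g \<Longrightarrow> computable (\<lambda>x. code_nth (f x) (g x))"
  unfolding code_nth_def code_tl_def[abs_def] by (intro computable_intros)

text \<open>The conjunct \<open>True\<close> gives the set the shape that
  \<open>computable_set_encode\<close> takes.\<close>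

lemma puzzle_digits_eq: "puzzle_digits M = {y. y < 20449 * M \<and> True}"
  by (auto simp: puzzle_digits_def)

lemma puzzle_init_eq:
  "prod_encode ` puzzle_init M = {y. y < Suc (prod_encode (143, 20449 * M)) \<and>
     (pfst y < 143 \<and> psnd y < 20449 * M \<and> psnd y mod 143 = pfst y)}"
proof (intro equalityI subsetI)
  fix y assume "y \<in> {y. y < Suc (prod_encode (143, 20449 * M)) \<and>
     (pfst y < 143 \<and> psnd y < 20449 * M \<and> psnd y mod 143 = pfst y)}"
  then have "(pfst y, psnd y) \<in> puzzle_init M"
    by (auto simp: puzzle_init_def puzzle_digits_def)
  then show "y \<in> prod_encode ` puzzle_init M"
    by (metis image_eqI prod_encode_pfst_psnd)
qed (auto simp: puzzle_init_def puzzle_digits_def less_Suc_eq_le intro!: prod_encode_mono)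

lemma rule_code_eq:
  "rule_code 26 (puzzle_rule M R1 R2) =
    set_encode {y. y < Suc (list_bound (20449 * M) 26) \<and> (code_tl ^^ 26) y = 0 \<and>
      (\<forall>n<26. (code_tl ^^ n) y \<noteq> 0 \<and> code_nth y n < 20449 * M) \<and> valid_line M R1 R2 (code_nth y)}"
  unfolding rule_code_def puzzle_rule_def puzzle_digits_def
  by (subst list_code_image) (simp_all cong: valid_line_cong)

lemma computable_puzzle_code_of: "computable puzzle_code_of"
  unfolding puzzle_code_of_def puzzle_code_def relation_code_def puzzle_init_eq rule_code_eq
    puzzle_digits_eq Let_def list_encode.simps list_bound_def code_tl_def[abs_def]
  by (intro computable_intros decidable_const computable_code_nth decidable_valid_line computable2_paired)

theorem puzzle_algorithm:
  obtains alg where "\<And>W R1 R2. domino_set W R1 R2 \<Longrightarrow> evaluates alg [domino_code W R1 R2]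
    (puzzle_code 26 (puzzle_digits (set_encode W)) (puzzle_rule (set_encode W) R1 R2)
      143 (puzzle_init (set_encode W)))"
proof -
  obtain alg where alg: "\<And>z. evaluates alg [z] (puzzle_code_of z)"
    using computable_puzzle_code_of unfolding computable_def by blast
  show thesis
  proof (rule that)
    fix W :: "nat set" and R1 R2 assume W: "domino_set W R1 R2"
    then have "finite R1" "finite R2"
      by (auto simp: domino_set_def dest: finite_subset)
    then have "puzzle_code_of (domino_code W R1 R2) =
      puzzle_code 26 (puzzle_digits (set_encode W)) (puzzle_rule (set_encode W) R1 R2)
        143 (puzzle_init (set_encode W))"
      unfolding puzzle_code_of_def domino_code_def
      by (simp add: code_nth_list_encode relation_decode_code Let_def del: list_encode.simps)
    then show "evaluates alg [domino_code W R1 R2]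
      (puzzle_code 26 (puzzle_digits (set_encode W)) (puzzle_rule (set_encode W) R1 R2)
        143 (puzzle_init (set_encode W)))"
      using alg by metis
  qed
qed

lemma puzzle_wf:
  assumes "domino_set W R1 R2"
  defines "M \<equiv> set_encode W"
  shows "sudoku_rule 26 (puzzle_digits M) (puzzle_rule M R1 R2)"
    and "initial_condition 143 (puzzle_digits M) (puzzle_init M)"
proof -
  from assms obtain w where w: "w \<in> W" "finite W" by (auto simp: domino_set_def)
  then have "M \<noteq> 0"
    by (auto simp: M_def set_encode_def)
  then show "sudoku_rule 26 (puzzle_digits M) (puzzle_rule M R1 R2)"
    by (auto simp: sudoku_rule_def puzzle_digits_def puzzle_rule_def)
  show "initial_condition 143 (puzzle_digits M) (puzzle_init M)"
    by (auto simp: initial_condition_def puzzle_init_def)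
qed

text \<open>As \<open>w < 2 ^ w\<close> and \<open>2 ^ w\<close> is a summand of the code, the code
  of \<open>W\<close> can itself serve as the bound \<open>M\<close> on the tiles.\<close>

lemma less_set_encode: "finite W \<Longrightarrow> w \<in> W \<Longrightarrow> w < set_encode W"
  unfolding set_encode_def
  by (rule less_le_trans[OF less_exp]) (simp add: member_le_sum)

section \<open>Recovering linear forms from digits on lines\<close>

lemma affine_two_roots:
  fixes a b p :: int and i j :: nat
  assumes "prime p" "3 < p" "i < j" "j < 4" "p dvd a * int i + b" "p dvd a * int j + b"
  shows "p dvd a \<and> p dvd b"
proof -
  have "p dvd a * (int j - int i)"
    using dvd_diff[OF assms(6,5)] by (simp add: algebra_simps)
  moreover have "\<not> p dvd int j - int i"
    using assms by (intro zdvd_not_zless) auto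
  ultimately have "p dvd a"
    using \<open>prime p\<close> prime_dvd_mult_iff by blast
  moreover from this have "p dvd b"
    using assms(5) dvd_add_right_iff dvd_mult2 by blast
  ultimately show ?thesis by simp
qed

text \<open>Pigeonhole: an affine function that is not zero modulo \<open>p\<close> has at most one
  root among 0, 1, 2, 3, so three of them cannot cover these four points.\<close>

lemma affine_covering:
  fixes a1 b1 a2 b2 a3 b3 p :: int
  assumes p: "prime p" "3 < p"
    and "\<not> (p dvd a1 \<and> p dvd b1)" "\<not> (p dvd a2 \<and> p dvd b2)"
    and cover: "\<And>n :: nat. n < 4 \<Longrightarrow> p dvd a1 * int n + b1 \<or> p dvd a2 * int n + b2 \<or> p dvd a3 * int n + b3"
  shows "p dvd a3 \<and> p dvd b3"
proof (rule ccontr)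
  assume "\<not> ?thesis"
  then have roots: "\<not> (p dvd a * int i + b \<and> p dvd a * int j + b)"
    if "i < j" "j < 4" "(a, b) \<in> {(a1, b1), (a2, b2), (a3, b3)}" for i j a b
    using that assms affine_two_roots[OF p that(1,2), of a b] by auto
  define P where "P a b i \<longleftrightarrow> p dvd a * int i + b" for a b i
  have "\<not> (P a b 0 \<and> P a b 1)" "\<not> (P a b 0 \<and> P a b 2)" "\<not> (P a b 0 \<and> P a b 3)"
       "\<not> (P a b 1 \<and> P a b 2)" "\<not> (P a b 1 \<and> P a b 3)" "\<not> (P a b 2 \<and> P a b 3)"
    if "(a, b) \<in> {(a1, b1), (a2, b2), (a3, b3)}" for a b
    unfolding P_def by (intro roots that; simp)+
  note * = this[of a1 b1] this[of a2 b2] this[of a3 b3]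
  have "P a1 b1 n \<or> P a2 b2 n \<or> P a3 b3 n" if "n < 4" for n
    using cover[OF that] by (simp add: P_def)
  from this[of 0] this[of 1] this[of 2] this[of 3] * show False
    by simp blast
qed

lemma exists_avoiding:
  fixes p :: int
  assumes "finite A" "int (card A) < p"
  shows "\<exists>b. \<forall>a\<in>A. \<not> [b = a] (mod p)"
proof -
  have "card ((\<lambda>a. a mod p) ` A) < card {0..<p}"
    using card_image_le[OF assms(1), of "\<lambda>a. a mod p"] assms(2) by simp
  then obtain b where "b \<in> {0..<p}" "b \<notin> (\<lambda>a. a mod p) ` A"
    by (metis card_mono finite_imageI assms(1) not_less subsetI)
  then show ?thesis
    by (intro exI[of _ b]) (auto simp: cong_def image_iff)
qed

text \<open>\<open>f y\<close> is the root of the linear form that the entry at height \<open>y\<close> predicts, unless \<open>y\<close> is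
  itself the root. By choosing a generic \<open>y'\<close> one sees that any four heights admit a common root.\<close>

lemma common_root:
  fixes f g :: "int \<Rightarrow> int" and p :: int
  assumes p: "8 < p"
    and fg: "\<And>y y'. \<not> [y = y'] (mod p) \<Longrightarrow>
      [f y = g y'] (mod p) \<or> [f y = y'] (mod p) \<or> [y = g y'] (mod p)"
  shows "\<exists>h. \<forall>y. [f y = h] (mod p) \<or> [y = h] (mod p)"
proof -
  have common: "\<exists>v. \<forall>a\<in>A. [f a = v] (mod p) \<or> [a = v] (mod p)" if A: "finite A" "card A \<le> 4" for A
  proof -
    have "card (A \<union> f ` A) \<le> 8"
      using card_Un_le[of A "f ` A"] card_image_le[OF A(1), of f] A(2) by simp
    then obtain b where b: "\<forall>a\<in>A \<union> f ` A. \<not> [b = a] (mod p)"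
      using exists_avoiding[of "A \<union> f ` A" p] A(1) p by auto
    have "[f a = g b] (mod p) \<or> [a = g b] (mod p)" if "a \<in> A" for a
      using fg[of a b] b that by (auto simp: cong_sym_eq)
    then show ?thesis by blast
  qed
  obtain h where h: "\<forall>a\<in>{0, 1, 2}. [f a = h] (mod p) \<or> [a = h] (mod p)"
    by (rule exE[OF common[of "{0, 1, 2}"]]) simp_all
  have "[f y = h] (mod p) \<or> [y = h] (mod p)" for y
  proof -
    have card4: "card {0, 1, 2, y} \<le> 4"
      by (auto simp: card_insert_if)
    obtain v where v: "\<forall>a\<in>{0, 1, 2, y}. [f a = v] (mod p) \<or> [a = v] (mod p)"
      by (rule exE[OF common[OF _ card4]]) simp_all
    have distinct: "\<not> ([i = w] (mod p) \<and> [j = w] (mod p))" if "0 \<le> i" "i < j" "j \<le> 2" for i j w :: int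
    proof
      assume "[i = w] (mod p) \<and> [j = w] (mod p)"
      then have "[i = j] (mod p)"
        using cong_sym cong_trans by blast
      then show False
        using that p by (simp add: cong_def)
    qed
    \<comment> \<open>Each of \<open>h\<close> and \<open>v\<close> is congruent to at most one of
      0, 1, 2. At a remaining \<open>i\<close> the value \<open>f i\<close> must agree with both, so
      \<open>h\<close> and \<open>v\<close> coincide.\<close>
    have "\<exists>i\<in>{0, 1, 2}. \<not> [i = h] (mod p) \<and> \<not> [i = v] (mod p)"
      using distinct[of 0 1] distinct[of 0 2] distinct[of 1 2] by simp blast
    then obtain i where i: "i \<in> {0, 1, 2}" "\<not> [i = h] (mod p)" "\<not> [i = v] (mod p)"
      by blast
    then have "[f i = h] (mod p)" "[f i = v] (mod p)"
      using h v by blast+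
    then have "[v = h] (mod p)"
      by (rule cong_trans[OF cong_sym, rotated])
    moreover have "[f y = v] (mod p) \<or> [y = v] (mod p)"
      using v by simp
    ultimately show ?thesis
      using cong_trans by blast
  qed
  then show ?thesis by blast
qed

text \<open>Every \<open>i\<close> yields an affine prediction for \<open>h\<close> that can fail
  only where \<open>h\<close> or the prediction equals \<open>i\<close>. For two generic values of
  \<open>i\<close> the predictions agree by \<open>affine_covering\<close>, and the second value can
  be kept away from any given column.\<close>

lemma affine_of_coverings:
  fixes h :: "nat \<Rightarrow> int" and p :: int
  assumes p: "prime p" "6 < p" and N: "4 \<le> N"
    and cover: "\<And>i. \<exists>A B. \<not> ([A = 0] (mod p) \<and> [B = i] (mod p)) \<and>
      (\<forall>n<N. [h n = i] (mod p) \<or> [A * int n + B = i] (mod p) \<or> [h n = A * int n + B] (mod p))"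
  shows "\<exists>k l. \<forall>n<N. [h n = k * int n + l] (mod p)"
proof -
  obtain i where i: "\<forall>a\<in>h ` {..<4}. \<not> [i = a] (mod p)"
    using exists_avoiding[of "h ` {..<4}" p] card_image_le[of "{..<4::nat}" h] p by auto
  from cover[of i] obtain A B where AB: "\<not> ([A = 0] (mod p) \<and> [B = i] (mod p))"
      "\<And>n. n < N \<Longrightarrow> [h n = i] (mod p) \<or> [A * int n + B = i] (mod p) \<or> [h n = A * int n + B] (mod p)"
    by auto
  have "[h m = A * int m + B] (mod p)" if m: "m < N" for m
  proof -
    let ?S = "insert (h m) (insert (A * int m + B) (h ` {..<4}))"
    have "card ?S \<le> 6"
      using card_image_le[of "{..<4::nat}" h] by (simp add: card_insert_if)
    \<comment> \<open>Avoiding \<open>h m\<close> and the first prediction at \<open>m\<close> as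
      well excludes both exceptional cases at column \<open>m\<close>.\<close>
    then obtain i' where i': "\<forall>a\<in>?S. \<not> [i' = a] (mod p)"
      using exists_avoiding[of ?S p] p by auto
    from cover[of i'] obtain A' B' where AB': "\<not> ([A' = 0] (mod p) \<and> [B' = i'] (mod p))"
        "\<And>n. n < N \<Longrightarrow> [h n = i'] (mod p) \<or> [A' * int n + B' = i'] (mod p) \<or>
          [h n = A' * int n + B'] (mod p)"
      by auto
    have "p dvd A - A' \<and> p dvd B - B'"
    proof (rule affine_covering[OF p(1)])
      show "\<not> (p dvd A \<and> p dvd B - i)" "\<not> (p dvd A' \<and> p dvd B' - i')"
        using AB(1) AB'(1) by (auto simp: cong_iff_dvd_diff)
      fix n :: nat assume n: "n < 4"
      then have "\<not> [h n = i] (mod p)" "\<not> [h n = i'] (mod p)"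
        using i i' cong_sym by blast+
      then have "[A * int n + B = i] (mod p) \<or> [A' * int n + B' = i'] (mod p) \<or>
          [A * int n + B = A' * int n + B'] (mod p)"
        using AB(2)[of n] AB'(2)[of n] n N cong_sym cong_trans
        by (smt (verit) order_less_le_trans)
      then show "p dvd A * int n + (B - i) \<or> p dvd A' * int n + (B' - i') \<or>
          p dvd (A - A') * int n + (B - B')"
        by (simp add: cong_iff_dvd_diff algebra_simps)
    qed (use p in simp)
    then have "[A * int m + B = A' * int m + B'] (mod p)"
      by (simp add: cong_iff_dvd_diff[symmetric] cong_add cong_mult)
    moreover have "\<not> [h m = i'] (mod p)" "\<not> [A * int m + B = i'] (mod p)"
      using i' cong_sym by blast+
    ultimately show ?thesis
      using AB'(2)[OF m] by (meson cong_sym cong_trans)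
  qed
  then show ?thesis by blast
qed

section \<open>The rule at a single prime and the digits of a linear form\<close>

text \<open>The conditions of \<open>fits\<close> with integers and divisibility in place of bounded
  residues, so that one argument serves both primes.\<close>

definition line_rule :: "int \<Rightarrow> nat \<Rightarrow> (nat \<Rightarrow> int \<Rightarrow> int) \<Rightarrow> bool" where
  "line_rule p N u \<longleftrightarrow> (\<forall>j i. \<exists>a b c. \<not> (p dvd a \<and> p dvd b) \<and>
     (\<forall>n<N. (\<not> p dvd a * int n + b \<longrightarrow> [u n (j * int n + i) = a * int n + b] (mod p)) \<and>
        (\<not> p dvd a \<longrightarrow> p dvd a * int n + b \<longrightarrow> \<not> p dvd a * (int n div p) + c \<longrightarrow>
          [u n (j * int n + i) = a * (int n div p) + c] (mod p))))"

text \<open>\<open>u\<close> is \<open>c\<close> times the last nonzero digit in base \<open>p\<close> of the form \<open>X = m - K n - L\<close>, as long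
  as \<open>p\<^sup>e\<close> does not divide \<open>X\<close>.\<close>

definition digit_form ::
  "int \<Rightarrow> nat \<Rightarrow> (nat \<Rightarrow> int \<Rightarrow> int) \<Rightarrow> int \<Rightarrow> nat \<Rightarrow> int \<Rightarrow> int \<Rightarrow> bool" where
  "digit_form p N u c e K L \<longleftrightarrow> (\<forall>n<N. \<forall>k<e. \<forall>z. \<not> p dvd z \<longrightarrow>
     [u n (K * int n + L + p ^ k * z) = c * z] (mod p))"

text \<open>A shift by a multiple of \<open>p ^ e\<close> replaces \<open>p ^ k * z\<close> with
  \<open>k < e\<close> by \<open>p ^ k * (z + p * w)\<close>, which leaves the last nonzero digit
  alone.\<close>

lemma digit_form_cong:
  assumes "digit_form p N u c e K L" "[K = K'] (mod p ^ e)" "[L = L'] (mod p ^ e)"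
  shows "digit_form p N u c e K' L'"
  unfolding digit_form_def
proof (intro allI impI)
  fix n k z assume n: "n < N" "k < e" "\<not> p dvd z"
  from assms(2,3) obtain s t where st: "K' = K + p ^ e * s" "L' = L + p ^ e * t"
    by (metis cong_iff_lin)
  have e: "p ^ e = p ^ k * (p * p ^ (e - k - 1))"
    using n by (simp flip: power_Suc power_add)
  define w where "w = p ^ (e - k - 1) * (s * int n + t)"
  have "K' * int n + L' + p ^ k * z = K * int n + L + p ^ k * (z + p * w)"
    unfolding st e w_def by (simp add: algebra_simps)
  moreover have "\<not> p dvd z + p * w"
    using n by (simp add: dvd_add_left_iff)
  ultimately have "[u n (K' * int n + L' + p ^ k * z) = c * (z + p * w)] (mod p)"
    using assms(1) n unfolding digit_form_def by metis
  also have "[c * (z + p * w) = c * z] (mod p)"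
    by (simp add: cong_iff_dvd_diff algebra_simps)
  finally show "[u n (K' * int n + L' + p ^ k * z) = c * z] (mod p)" .
qed

text \<open>Away from the roots of \<open>s * n + r\<close> and \<open>a * n + b\<close>, both the
  form and the rule determine the digit. Their difference is affine and vanishes there, so
  \<open>affine_covering\<close> makes it zero: the parameters of the rule are forced.\<close>

lemma line_rule_params:
  assumes p: "prime p" "3 < p" and N: "4 \<le> N" and c: "\<not> p dvd c"
    and form: "digit_form p N u c e K L" and k: "k < e" and s: "\<not> p dvd s" and Q: "\<not> p dvd Q"
    and rule: "\<not> (p dvd a \<and> p dvd b)" "\<forall>n<N. \<not> p dvd a * int n + b \<longrightarrow>
       [u n ((K + p ^ k * Q * s) * int n + (L + p ^ k * Q * r)) = a * int n + b] (mod p)"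
  shows "[a = c * Q * s] (mod p) \<and> [b = c * Q * r] (mod p)"
proof -
  have "p dvd (a - c * Q * s) \<and> p dvd (b - c * Q * r)"
  proof (rule affine_covering[OF p])
    show "\<not> (p dvd s \<and> p dvd r)" "\<not> (p dvd a \<and> p dvd b)"
      using s rule by auto
    fix n :: nat assume n: "n < 4"
    show "p dvd s * int n + r \<or> p dvd a * int n + b \<or>
        p dvd (a - c * Q * s) * int n + (b - c * Q * r)"
    proof (rule ccontr)
      assume *: "\<not> ?thesis"
      let ?m = "(K + p ^ k * Q * s) * int n + (L + p ^ k * Q * r)"
      have "\<not> p dvd Q * (s * int n + r)"
        using * p Q prime_dvd_mult_iff by blast
      then have "[u n (K * int n + L + p ^ k * (Q * (s * int n + r))) = c * (Q * (s * int n + r))] (mod p)"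
        using form n N k unfolding digit_form_def by auto
      moreover have "K * int n + L + p ^ k * (Q * (s * int n + r)) = ?m"
        by (simp add: algebra_simps)
      moreover have "[u n ?m = a * int n + b] (mod p)"
        using rule(2) * n N by auto
      ultimately have "[a * int n + b = c * (Q * (s * int n + r))] (mod p)"
        by (metis cong_sym cong_trans)
      then show False
        using * by (simp add: cong_iff_dvd_diff algebra_simps)
    qed
  qed
  then show ?thesis by (simp add: cong_iff_dvd_diff)
qed

text \<open>A line of invertible slope meets the next sublattice in columns \<open>n\<close> and
  \<open>n + p\<close>, and the rule ties the digits there to \<open>w\<close> and
  \<open>w + a\<close> with \<open>a\<close> congruent to \<open>c * s\<close>. Both digits
  therefore predict the same root \<open>y - c' * w\<close>.\<close>

lemma digit_form_step_roots:
  fixes p c :: int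
  assumes p: "prime p" "10 < p" and N: "n + nat p < N" and c: "\<not> p dvd c" "[c * c' = 1] (mod p)"
    and rule: "line_rule p N u" and form: "digit_form p N u c (Suc k) K L"
    and y: "\<not> [y = y'] (mod p)"
  defines "f \<equiv> \<lambda>n y. y - c' * u n (K * int n + L + p ^ Suc k * y)"
  shows "[f n y = f (n + nat p) y'] (mod p) \<or> [f n y = y'] (mod p) \<or> [y = f (n + nat p) y'] (mod p)"
proof -
  define s where "s = y' - y"
  \<comment> \<open>Then \<open>s * t + r\<close> is \<open>p * y\<close> at \<open>t = n\<close>
    and \<open>p * y'\<close> at \<open>t = n + p\<close>, so the line passes through both chosen
    cells.\<close>
  define r where "r = p * y - s * int n"
  have s: "\<not> p dvd s"
    using y unfolding s_def by (metis cong_iff_dvd_diff cong_sym)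
  from rule obtain a b d where ab: "\<not> (p dvd a \<and> p dvd b)"
     "\<forall>n<N. \<not> p dvd a * int n + b \<longrightarrow>
       [u n ((K + p ^ k * 1 * s) * int n + (L + p ^ k * 1 * r)) = a * int n + b] (mod p)"
     "\<forall>n<N. \<not> p dvd a \<longrightarrow> p dvd a * int n + b \<longrightarrow> \<not> p dvd a * (int n div p) + d \<longrightarrow>
       [u n ((K + p ^ k * 1 * s) * int n + (L + p ^ k * 1 * r)) = a * (int n div p) + d] (mod p)"
    unfolding line_rule_def by metis
  have "[a = c * 1 * s] (mod p) \<and> [b = c * 1 * r] (mod p)"
    by (rule line_rule_params[OF p(1) _ _ c(1) form _ s _ ab(1,2)]) (use p N in auto)
  then have a: "[a = c * s] (mod p)" and b: "[b = c * r] (mod p)"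
    by simp_all
  have pa: "\<not> p dvd a"
    using a s c(1) p(1) by (metis cong_dvd_iff prime_dvd_mult_iff)
  have root: "p dvd a * int t + b" if "p dvd s * int t + r" for t
  proof -
    have "[a * int t + b = c * (s * int t + r)] (mod p)"
      using cong_add[OF cong_mult[OF a cong_refl[of "int t"]] b] by (simp add: algebra_simps)
    then show ?thesis
      using that by (metis cong_dvd_iff dvd_mult)
  qed
  define w where "w = a * (int n div p) + d"
  have "[u n (K * int n + L + p ^ Suc k * y) = w] (mod p)" if "\<not> p dvd w"
  proof -
    have "(K + p ^ k * 1 * s) * int n + (L + p ^ k * 1 * r) = K * int n + L + p ^ Suc k * y"
      by (simp add: r_def algebra_simps)
    moreover have "p dvd a * int n + b"
      by (rule root) (simp add: r_def)
    ultimately show ?thesis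
      using ab(3) pa that N unfolding w_def by (metis add_lessD1)
  qed
  moreover have "[u (n + nat p) (K * int (n + nat p) + L + p ^ Suc k * y') = w + a] (mod p)"
    if "\<not> p dvd w + a"
  proof -
    have np: "int (n + nat p) = int n + p" using p by simp
    have "(K + p ^ k * 1 * s) * int (n + nat p) + (L + p ^ k * 1 * r) =
        K * int (n + nat p) + L + p ^ Suc k * y'"
      unfolding np by (simp add: r_def s_def algebra_simps)
    moreover have "p dvd a * int (n + nat p) + b"
      by (rule root) (simp add: r_def np algebra_simps)
    moreover have "a * (int (n + nat p) div p) + d = w + a"
      unfolding np w_def using p by (simp add: algebra_simps)
    ultimately show ?thesis
      using ab(3) pa that N by metis
  qed
  moreover have "[c' * (w + a) = c' * w + s] (mod p)"
  proof -
    have "[c' * a = c' * (c * s)] (mod p)" by (rule cong_mult[OF cong_refl a])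
    also have "c' * (c * s) = c * c' * s" by simp
    also have "[c * c' * s = 1 * s] (mod p)" by (rule cong_mult[OF c(2) cong_refl])
    finally have "[c' * a = s] (mod p)" by simp
    from cong_add[OF this cong_refl[of "c' * w"]] show ?thesis
      by (simp add: algebra_simps)
  qed
  ultimately have 1: "\<not> p dvd w \<Longrightarrow> [f n y = y - c' * w] (mod p)"
    and 2: "\<not> p dvd w + a \<Longrightarrow> [f (n + nat p) y' = y' - (c' * w + s)] (mod p)"
    and 3: "[c' * (w + a) = c' * w + s] (mod p)"
    unfolding f_def by (meson cong_diff cong_mult cong_refl cong_trans)+
  \<comment> \<open>If \<open>p\<close> divides \<open>w\<close>, the rule is silent about the
    digit, but then \<open>y\<close> itself is the predicted root; likewise \<open>y'\<close> if
    \<open>p\<close> divides \<open>w + a\<close>.\<close>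
  have "p dvd w \<Longrightarrow> [y = y - c' * w] (mod p)"
    by (simp add: cong_iff_dvd_diff)
  moreover have "[y' = y - c' * w] (mod p)" if "p dvd w + a"
  proof -
    have "p dvd c' * w + s"
      using that cong_dvd_iff[OF 3] by simp
    then show ?thesis
      by (simp add: cong_iff_dvd_diff s_def algebra_simps)
  qed
  moreover have "y' - (c' * w + s) = y - c' * w"
    by (simp add: s_def)
  ultimately have "[f n y = y - c' * w] (mod p) \<or> [y = y - c' * w] (mod p)"
      "[f (n + nat p) y' = y - c' * w] (mod p) \<or> [y' = y - c' * w] (mod p)"
    using 1 2 by metis+
  moreover have "[v = v'] (mod p)" if "[v = x] (mod p)" "[v' = x] (mod p)" for v v' x
    using cong_trans[OF that(1) cong_sym[OF that(2)]] .
  ultimately show ?thesis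
    using y by blast
qed

text \<open>Pairing each column with one at distance \<open>p\<close> gives a root
  \<open>h n\<close> of the digits on the next sublattice. The lines within that sublattice make
  \<open>h\<close> affine, and its coefficients extend \<open>K\<close> and \<open>L\<close> by one
  more power of \<open>p\<close>.\<close>

theorem digit_form_step:
  fixes p c :: int
  assumes p: "prime p" "10 < p" and N: "2 * nat p \<le> N" and c: "\<not> p dvd c"
    and rule: "line_rule p N u" and form: "digit_form p N u c (Suc e) K L"
  obtains k l where "digit_form p N u c (Suc (Suc e)) (K + p ^ Suc e * k) (L + p ^ Suc e * l)"
proof -
  have "coprime c p"
    using p c prime_imp_coprime coprime_commute by blast
  then obtain c' where c': "[c * c' = 1] (mod p)"
    using cong_solve_coprime_int by blast
  define G where "G n y = u n (K * int n + L + p ^ Suc e * y)" for n y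
  \<comment> \<open>Since \<open>2 * p \<le> N\<close>, the partner at distance \<open>p\<close>
    exists on the right or on the left.\<close>
  have "\<exists>h. \<forall>y. [y - c' * G n y = h] (mod p) \<or> [y = h] (mod p)" if n: "n < N" for n
  proof (cases "n + nat p < N")
    case True
    show ?thesis
      by (rule common_root[of p _ "\<lambda>y. y - c' * G (n + nat p) y"])
         (use digit_form_step_roots[OF p True c c' rule form] p in \<open>auto simp: G_def\<close>)
  next
    case False
    then have n: "n - nat p + nat p = n" "n - nat p + nat p < N"
      using n N by auto
    show ?thesis
    proof (rule common_root[of p _ "\<lambda>y. y - c' * G (n - nat p) y"])
      fix y y' :: int assume "\<not> [y = y'] (mod p)"
      then have "\<not> [y' = y] (mod p)" by (simp add: cong_sym_eq)
      from digit_form_step_roots[OF p n(2) c c' rule form this, unfolded n(1), folded G_def]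
      show "[y - c' * G n y = y' - c' * G (n - nat p) y'] (mod p) \<or>
          [y - c' * G n y = y'] (mod p) \<or> [y = y' - c' * G (n - nat p) y'] (mod p)"
        using cong_sym by blast
    qed (use p in simp)
  qed
  then obtain h where h: "\<And>n y. n < N \<Longrightarrow> [y - c' * G n y = h n] (mod p) \<or> [y = h n] (mod p)"
    by metis
  have G: "[G n y = c * (y - h n)] (mod p)" if "n < N" "\<not> [y = h n] (mod p)" for n y
  proof -
    have "p dvd c * (y - c' * G n y - h n) + (c * c' - 1) * G n y"
      using h[OF that(1), of y] that(2) c' by (simp add: cong_iff_dvd_diff)
    then have "p dvd c * (y - h n) - G n y"
      by (simp add: algebra_simps)
    then show ?thesis
      by (simp add: cong_iff_dvd_diff dvd_diff_commute)
  qed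
  \<comment> \<open>The line of slope \<open>K\<close> through \<open>L + p ^ Suc e * i\<close>
    keeps the sublattice height \<open>i\<close> constant; its digits \<open>a * n + b\<close>
    predict the root \<open>i - c' * (a * n + b)\<close>.\<close>
  have "\<exists>k l. \<forall>n<N. [h n = k * int n + l] (mod p)"
  proof (rule affine_of_coverings[OF p(1)])
    fix i
    from rule obtain a b where ab: "\<not> (p dvd a \<and> p dvd b)"
      "\<forall>n<N. \<not> p dvd a * int n + b \<longrightarrow>
        [u n (K * int n + (L + p ^ Suc e * i)) = a * int n + b] (mod p)"
      unfolding line_rule_def by metis
    define A B where "A = - c' * a" and "B = i - c' * b"
    have c'a: "p dvd c' * x \<longleftrightarrow> p dvd x" for x
    proof -
      have "\<not> p dvd c'"
        using c' p(1) cong_dvd_iff not_prime_unit by (metis dvd_mult)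
      then show ?thesis using p(1) prime_dvd_mult_iff by blast
    qed
    have "\<not> ([A = 0] (mod p) \<and> [B = i] (mod p))"
      using ab(1) by (simp add: A_def B_def cong_iff_dvd_diff c'a)
    moreover have "[h n = i] (mod p) \<or> [A * int n + B = i] (mod p) \<or> [h n = A * int n + B] (mod p)"
      if n: "n < N" for n
    proof (rule ccontr)
      assume "\<not> ?thesis"
      then have 1: "\<not> [h n = A * int n + B] (mod p)" and 2: "\<not> [A * int n + B = i] (mod p)"
        and 3: "\<not> [h n = i] (mod p)"
        by blast+
      have "A * int n + B - i = c' * (- (a * int n + b))"
        by (simp add: A_def B_def algebra_simps)
      then have "\<not> p dvd a * int n + b"
        using 2 by (metis c'a cong_iff_dvd_diff dvd_minus_iff)
      then have "[G n i = a * int n + b] (mod p)"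
        using ab(2) n unfolding G_def by (metis add.assoc)
      have "[i - c' * G n i = h n] (mod p)"
        using 3 h[OF n, of i] cong_sym by blast
      moreover have "[i - c' * G n i = i - c' * (a * int n + b)] (mod p)"
        by (intro cong_diff cong_mult cong_refl) fact
      moreover have "i - c' * (a * int n + b) = A * int n + B"
        by (simp add: A_def B_def algebra_simps)
      ultimately show False
        using 1 by (metis cong_sym cong_trans)
    qed
    ultimately show "\<exists>A B. \<not> ([A = 0] (mod p) \<and> [B = i] (mod p)) \<and>
      (\<forall>n<N. [h n = i] (mod p) \<or> [A * int n + B = i] (mod p) \<or> [h n = A * int n + B] (mod p))"
      by blast
  qed (use p N in auto)
  then obtain k l where kl: "\<And>n. n < N \<Longrightarrow> [h n = k * int n + l] (mod p)"
    by blast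
  have "digit_form p N u c (Suc (Suc e)) (K + p ^ Suc e * k) (L + p ^ Suc e * l)"
    unfolding digit_form_def
  proof (intro allI impI)
    fix n j z assume n: "n < N" "j < Suc (Suc e)" "\<not> p dvd z"
    show "[u n ((K + p ^ Suc e * k) * int n + (L + p ^ Suc e * l) + p ^ j * z) = c * z] (mod p)"
    proof (cases "j < Suc e")
      case True
      have "digit_form p N u c (Suc e) (K + p ^ Suc e * k) (L + p ^ Suc e * l)"
        by (rule digit_form_cong[OF form]) (simp_all add: cong_iff_dvd_diff)
      with n True show ?thesis unfolding digit_form_def by blast
    next
      case False
      with n have j: "j = Suc e" by simp
      define y where "y = z + k * int n + l"
      have "p dvd y - h n - z"
        using kl[OF n(1)] by (simp add: y_def cong_iff_dvd_diff dvd_diff_commute algebra_simps)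
      then have yz: "[y - h n = z] (mod p)"
        by (simp add: cong_iff_dvd_diff)
      then have "\<not> [y = h n] (mod p)"
        using n(3) cong_dvd_iff by (metis cong_iff_dvd_diff)
      then have "[G n y = c * (y - h n)] (mod p)"
        by (rule G[OF n(1)])
      also have "[c * (y - h n) = c * z] (mod p)"
        by (intro cong_mult cong_refl yz)
      finally show ?thesis
        unfolding G_def y_def j by (simp add: algebra_simps)
    qed
  qed
  then show thesis by (rule that)
qed

section \<open>Linear forms from affine lines\<close>

lemma affine_of_increments:
  fixes f :: "int \<Rightarrow> int"
  assumes "\<And>x. [f (x + 1) = f x + c] (mod q)"
  shows "[f x = f 0 + c * x] (mod q)"
proof (induction x rule: int_induct[where k = 0])
  case base
  show ?case by simp
next
  case (step1 i)
  have "[f i + c = f 0 + c * i + c] (mod q)"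
    using step1(2) by (rule cong_add[OF _ cong_refl])
  with assms[of i] show ?case
    by (simp add: algebra_simps) (metis cong_trans)
next
  case (step2 i)
  have "[f i - c = f 0 + c * i - c] (mod q)"
    using step2(2) by (rule cong_diff[OF _ cong_refl])
  moreover have "[f (i - 1) = f i - c] (mod q)"
    using assms[of "i - 1"] by (simp add: cong_iff_dvd_diff dvd_diff_commute algebra_simps)
  ultimately show ?case
    by (simp add: algebra_simps) (metis cong_trans)
qed

text \<open>The columns 0, 1, 2 satisfy \<open>h (2 b - a) = 2 g b - f a\<close>; increasing \<open>a\<close> by 2 and \<open>b\<close> by 1
  shows that \<open>f\<close> and \<open>g\<close> have constant increments.\<close>

lemma affine_of_lines:
  fixes w :: "nat \<Rightarrow> int \<Rightarrow> int" and q :: int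
  assumes q: "odd q" and N: "3 \<le> N"
    and lines: "\<And>j i. \<exists>A B. \<forall>n<N. [w n (j * int n + i) = A * int n + B] (mod q)"
    and periodic: "\<And>m. [w 0 (m + q) = w 0 m] (mod q)"
  shows "\<exists>c e d. \<forall>n<N. \<forall>m. [w n m = c * m + e * int n + d] (mod q)"
proof -
  have interpolation: "[w n ((b - a) * int n + a) = w 0 a + int n * (w 1 b - w 0 a)] (mod q)"
    if n: "n < N" for n a b
  proof -
    from lines[of "b - a" a] obtain A B
      where AB: "\<And>n. n < N \<Longrightarrow> [w n ((b - a) * int n + a) = A * int n + B] (mod q)"
      by blast
    have B: "[w 0 a = B] (mod q)" and A: "[w 1 b = A + B] (mod q)"
      using AB[of 0] AB[of 1] N by auto
    have "[w 0 a + int n * (w 1 b - w 0 a) = B + int n * (A + B - B)] (mod q)"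
      by (intro cong_add cong_mult cong_diff A B cong_refl)
    with AB[OF n] show ?thesis
      by (simp add: algebra_simps) (metis cong_sym cong_trans)
  qed
  have diff: "[w 0 (a + 2) - w 0 a = 2 * (w 1 (b + 1) - w 1 b)] (mod q)" for a b
  proof -
    have "(b - a) * int 2 + a = (b + 1 - (a + 2)) * int 2 + (a + 2)"
      by simp
    then have "[w 0 a + 2 * (w 1 b - w 0 a) = w 0 (a + 2) + 2 * (w 1 (b + 1) - w 0 (a + 2))] (mod q)"
      using interpolation[of 2 b a] interpolation[of 2 "b + 1" "a + 2"] N
      by (metis (no_types, lifting) Suc_le_lessD cong_sym cong_trans eval_nat_numeral(3) of_nat_numeral)
    then show ?thesis
      by (simp add: cong_iff_dvd_diff algebra_simps)
  qed
  define c where "c = w 1 1 - w 1 0"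
  have "[w 1 (b + 1) = w 1 b + c] (mod q)" for b
  proof -
    have "[2 * (w 1 (b + 1) - w 1 b) = 2 * c] (mod q)"
      using diff[of 0 b] diff[of 0 0] unfolding c_def by (metis add_0 cong_sym cong_trans)
    then have "q dvd 2 * (w 1 (b + 1) - w 1 b - c)"
      by (simp add: cong_iff_dvd_diff algebra_simps)
    then have "q dvd w 1 (b + 1) - w 1 b - c"
      using q coprime_dvd_mult_right_iff by (metis coprime_right_2_iff_odd)
    then show ?thesis
      by (simp add: cong_iff_dvd_diff algebra_simps)
  qed
  then have w1: "[w 1 b = w 1 0 + c * b] (mod q)" for b
    by (rule affine_of_increments)
  have w0_2: "[w 0 (a + 2 * k) = w 0 a + 2 * c * k] (mod q)" for a k
  proof -
    have "[w 0 (a + 2 * (k + 1)) = w 0 (a + 2 * k) + 2 * c] (mod q)" for k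
      using diff[of "a + 2 * k" 0] by (simp add: c_def cong_iff_dvd_diff algebra_simps)
    from affine_of_increments[of "\<lambda>k. w 0 (a + 2 * k)", OF this] show ?thesis by simp
  qed
  have "[w 0 (a + 1) = w 0 a + c] (mod q)" for a
  proof -
    \<comment> \<open>Because \<open>q\<close> is odd, \<open>k\<close> steps of length 2 amount to
      one step of length 1, up to the period \<open>q\<close>.\<close>
    obtain k where k: "q + 1 = 2 * k"
      using q by (metis dvdE even_plus_one_iff)
    have "[w 0 (a + 2 * k) = w 0 (a + 1)] (mod q)"
      using periodic[of "a + 1"] unfolding k[symmetric] by (simp add: algebra_simps)
    moreover have "[w 0 a + 2 * c * k = w 0 a + c] (mod q)"
    proof -
      have "2 * c * k - c = c * (2 * k) - c" by simp
      also have "\<dots> = c * q" unfolding k[symmetric] by (simp add: algebra_simps)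
      finally have "2 * c * k - c = c * q" .
      then show ?thesis by (simp add: cong_iff_dvd_diff)
    qed
    ultimately show ?thesis
      using w0_2[of a k] by (meson cong_sym cong_trans)
  qed
  then have w0: "[w 0 a = w 0 0 + c * a] (mod q)" for a
    by (rule affine_of_increments)
  have "[w n m = c * m + (w 1 0 - w 0 0) * int n + w 0 0] (mod q)" if n: "n < N" for n m
  proof -
    have "[w n m = w 0 m + int n * (w 1 m - w 0 m)] (mod q)"
      using interpolation[OF n, of m m] by simp
    also have "[w 0 m + int n * (w 1 m - w 0 m) =
        w 0 0 + c * m + int n * (w 1 0 + c * m - (w 0 0 + c * m))] (mod q)"
      by (intro cong_add cong_mult cong_diff cong_refl w0 w1)
    finally show ?thesis by (simp add: algebra_simps)
  qed
  then show ?thesis by blast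
qed

text \<open>If \<open>p\<close> divided \<open>d\<close>, the entries of the line at \<open>n = 0\<close> and \<open>n = p\<close> could not both have the
  next valuation.\<close>

lemma line_rule_offset:
  fixes p :: int
  assumes p: "prime p" "3 < p" and N: "nat p < N" and c: "\<not> p dvd c"
    and form: "digit_form p N u c e K L" and k: "Suc k < e" and Q: "\<not> p dvd Q"
    and s: "\<not> p dvd s" "\<not> p dvd s + 1"
    and rule: "\<not> (p dvd a \<and> p dvd b)" "\<forall>n<N. \<not> p dvd a * int n + b \<longrightarrow>
       [u n ((K + p ^ k * Q * s) * int n + (L + p ^ k * Q * p)) = a * int n + b] (mod p)"
       "\<forall>n<N. \<not> p dvd a \<longrightarrow> p dvd a * int n + b \<longrightarrow> \<not> p dvd a * (int n div p) + d \<longrightarrow>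
       [u n ((K + p ^ k * Q * s) * int n + (L + p ^ k * Q * p)) = a * (int n div p) + d] (mod p)"
  shows "\<not> p dvd d"
proof
  assume d: "p dvd d"
  have "[a = c * Q * s] (mod p) \<and> [b = c * Q * p] (mod p)"
    by (rule line_rule_params[OF p _ c form _ s(1) Q rule(1,2)]) (use p N k in auto)
  then have a: "[a = c * Q * s] (mod p)" and b: "p dvd b"
    using cong_dvd_iff by (auto simp: cong_dvd_iff)
  have pa: "\<not> p dvd a"
    using a s(1) c Q p(1) by (metis cong_dvd_iff prime_dvd_mult_iff)
  \<comment> \<open>At column \<open>p\<close> the rule predicts \<open>a + d\<close>, that is
    \<open>c * Q * s\<close>, whereas the form yields \<open>c * Q * (s + 1)\<close>.\<close>
  let ?n = "nat p" and ?m = "(K + p ^ k * Q * s) * p + (L + p ^ k * Q * p)"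
  have n: "int ?n = p" using p by simp
  have "[u ?n ?m = a * (int ?n div p) + d] (mod p)"
    using rule(3) N pa b d p by (auto simp: n dvd_add_left_iff)
  moreover have "[a * (int ?n div p) + d = c * Q * s + 0] (mod p)"
    using a d p by (intro cong_add) (auto simp: n cong_iff_dvd_diff)
  moreover have "[u ?n ?m = c * (Q * (s + 1))] (mod p)"
  proof -
    have "\<not> p dvd Q * (s + 1)" using Q s(2) p(1) prime_dvd_mult_iff by blast
    then have "[u ?n (K * int ?n + L + p ^ Suc k * (Q * (s + 1))) = c * (Q * (s + 1))] (mod p)"
      using form N k unfolding digit_form_def by blast
    moreover have "K * int ?n + L + p ^ Suc k * (Q * (s + 1)) = ?m"
      unfolding n by (simp add: algebra_simps)
    ultimately show ?thesis by (simp only:)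
  qed
  ultimately have "[c * (Q * (s + 1)) = c * Q * s + 0] (mod p)"
    by (metis cong_sym cong_trans)
  then have "p dvd c * Q"
    by (simp add: cong_iff_dvd_diff algebra_simps)
  then show False using c Q p(1) prime_dvd_mult_iff by blast
qed

section \<open>From Sudoku solutions to tilings\<close>

locale puzzle_solution =
  fixes M :: nat and R1 R2 :: "(nat \<times> nat) set" and F :: "nat \<times> int \<Rightarrow> nat"
  assumes lines: "valid_line M R1 R2 (\<lambda>n. F (n, j * int n + i))"
    and columns: "n < 26 \<Longrightarrow> \<exists>\<sigma>. \<sigma> permutes {0..<143} \<and> (\<forall>m. F (n, m) mod 143 = \<sigma> (residue 143 m))"
begin

definition u11 :: "nat \<Rightarrow> int \<Rightarrow> int" where "u11 n m = int (digit11 (F (n, m)))"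
definition u13 :: "nat \<Rightarrow> int \<Rightarrow> int" where "u13 n m = int (digit13 (F (n, m)))"

text \<open>Translates \<open>valid_line\<close> to integers. The tile clauses at the second
  valuation are stated for column 0, where the neighbouring tiles are later compared.\<close>

lemma line_params:
  obtains a b c a' b' c' :: int and s s1 s2 where
    "(s, s1) \<in> R1" "(s, s2) \<in> R2"
    "\<not> (11 dvd a \<and> 11 dvd b)"
    "\<forall>n<26. \<not> 11 dvd a * int n + b \<longrightarrow> [u11 n (j * int n + i) = a * int n + b] (mod 11)"
    "\<forall>n<26. \<not> 11 dvd a \<longrightarrow> 11 dvd a * int n + b \<longrightarrow> \<not> 11 dvd a * (int n div 11) + c \<longrightarrow>
      [u11 n (j * int n + i) = a * (int n div 11) + c] (mod 11)"
    "\<not> (13 dvd a' \<and> 13 dvd b')"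
    "\<forall>n<26. \<not> 13 dvd a' * int n + b' \<longrightarrow> [u13 n (j * int n + i) = a' * int n + b'] (mod 13)"
    "\<forall>n<26. \<not> 13 dvd a' \<longrightarrow> 13 dvd a' * int n + b' \<longrightarrow> \<not> 13 dvd a' * (int n div 13) + c' \<longrightarrow>
      [u13 n (j * int n + i) = a' * (int n div 13) + c'] (mod 13)"
    "\<forall>n<26. \<not> 11 dvd a * int n + b \<longrightarrow> \<not> 13 dvd a' * int n + b' \<longrightarrow> tile (F (n, j * int n + i)) = s"
    "\<not> 11 dvd a \<longrightarrow> 11 dvd b \<longrightarrow> \<not> 11 dvd c \<longrightarrow> \<not> 13 dvd b' \<longrightarrow> tile (F (0, i)) = s1"
    "\<not> 11 dvd b \<longrightarrow> \<not> 13 dvd a' \<longrightarrow> 13 dvd b' \<longrightarrow> \<not> 13 dvd c' \<longrightarrow> tile (F (0, i)) = s2"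
proof -
  let ?g = "\<lambda>n. F (n, j * int n + i)"
  from lines[of j i] obtain a b c a' b' c' s s1 s2 where
    R: "(s, s1) \<in> R1" "(s, s2) \<in> R2" and
    less: "a < 11" "b < 11" "a' < 13" "b' < 13" "a \<noteq> 0 \<or> b \<noteq> 0" "a' \<noteq> 0 \<or> b' \<noteq> 0" and
    fit: "\<forall>n<26. fits 11 a b c n (digit11 (?g n)) \<and> fits 13 a' b' c' n (digit13 (?g n)) \<and>
          tiles_fit a b c a' b' c' s s1 s2 n (tile (?g n))"
    unfolding valid_line_def by blast
  have level0: "level0 p a b n \<longleftrightarrow> \<not> int p dvd int a * int n + int b" for p a b n
    by (simp add: level0_def mod_eq_0_iff_dvd flip: of_nat_mult of_nat_add)
  have level1: "level1 p a b c n \<longleftrightarrow> a \<noteq> 0 \<and> int p dvd int a * int n + int b \<and>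
      \<not> int p dvd int a * (int n div int p) + int c" for p a b c n
    by (simp add: level1_def mod_eq_0_iff_dvd flip: of_nat_mult of_nat_add of_nat_div)
  have cong: "[int (m mod p) = int m] (mod int p)" for m p
    by (simp add: cong_def zmod_int)
  have c0: "[int u = int a * int n + int b] (mod int p)" if "u = (a * n + b) mod p" for u a b n p
    using cong[of "a * n + b" p] that by simp
  have c1: "[int u = int a * (int n div int p) + int c] (mod int p)" if "u = (a * (n div p) + c) mod p"
    for u a c n p
    using cong[of "a * (n div p) + c" p] that by (simp add: zdiv_int)
  have pos: "\<not> int p dvd int a \<Longrightarrow> a \<noteq> 0" for p a
    by (metis dvd_0_right of_nat_0)
  have zero: "n < 26 \<Longrightarrow> tiles_fit a b c a' b' c' s s1 s2 n (tile (?g n))" for n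
    using fit by blast
  show thesis
  proof (rule that[OF R])
    show "\<not> (11 dvd int a \<and> 11 dvd int b)"
      using less by (auto dest!: zdvd_imp_le)
    show "\<not> (13 dvd int a' \<and> 13 dvd int b')"
      using less by (auto dest!: zdvd_imp_le)
    show "\<forall>n<26. \<not> 11 dvd int a * int n + int b \<longrightarrow>
        [u11 n (j * int n + i) = int a * int n + int b] (mod 11)"
      using fit c0[where p = 11] level0[of 11] unfolding u11_def fits_def by simp
    show "\<forall>n<26. \<not> 13 dvd int a' * int n + int b' \<longrightarrow>
        [u13 n (j * int n + i) = int a' * int n + int b'] (mod 13)"
      using fit c0[where p = 13] level0[of 13] unfolding u13_def fits_def by simp
    show "\<forall>n<26. \<not> 11 dvd int a \<longrightarrow> 11 dvd int a * int n + int b \<longrightarrow>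
        \<not> 11 dvd int a * (int n div 11) + int c \<longrightarrow>
        [u11 n (j * int n + i) = int a * (int n div 11) + int c] (mod 11)"
      using fit c1[where p = 11] level1[of 11] pos[of 11 a] unfolding u11_def fits_def by simp
    show "\<forall>n<26. \<not> 13 dvd int a' \<longrightarrow> 13 dvd int a' * int n + int b' \<longrightarrow>
        \<not> 13 dvd int a' * (int n div 13) + int c' \<longrightarrow>
        [u13 n (j * int n + i) = int a' * (int n div 13) + int c'] (mod 13)"
      using fit c1[where p = 13] level1[of 13] pos[of 13 a'] unfolding u13_def fits_def by simp
    show "\<forall>n<26. \<not> 11 dvd int a * int n + int b \<longrightarrow> \<not> 13 dvd int a' * int n + int b' \<longrightarrow>
        tile (F (n, j * int n + i)) = s"
      using zero level0[of 11] level0[of 13] unfolding tiles_fit_def by simp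
    show "\<not> 11 dvd int a \<longrightarrow> 11 dvd int b \<longrightarrow> \<not> 11 dvd int c \<longrightarrow> \<not> 13 dvd int b' \<longrightarrow>
        tile (F (0, i)) = s1"
      using zero[of 0] level1[of 11 _ _ _ 0] level0[of 13 _ _ 0] pos[of 11 a]
      unfolding tiles_fit_def by simp
    show "\<not> 11 dvd int b \<longrightarrow> \<not> 13 dvd int a' \<longrightarrow> 13 dvd int b' \<longrightarrow> \<not> 13 dvd int c' \<longrightarrow>
        tile (F (0, i)) = s2"
      using zero[of 0] level1[of 13 _ _ _ 0] level0[of 11 _ _ 0] pos[of 13 a']
      unfolding tiles_fit_def by simp
  qed
qed

lemma line_rule_11: "line_rule 11 26 u11"
  unfolding line_rule_def
proof (intro allI)
  fix j i
  obtain a b c a' b' c' :: int and s s1 s2 :: nat where ab: "\<not> (11 dvd a \<and> 11 dvd b)"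
    and 0: "\<forall>n<26. \<not> 11 dvd a * int n + b \<longrightarrow> [u11 n (j * int n + i) = a * int n + b] (mod 11)"
    and 1: "\<forall>n<26. \<not> 11 dvd a \<longrightarrow> 11 dvd a * int n + b \<longrightarrow> \<not> 11 dvd a * (int n div 11) + c \<longrightarrow>
      [u11 n (j * int n + i) = a * (int n div 11) + c] (mod 11)"
    by (rule line_params[of j i])
  show "\<exists>a b c. \<not> (11 dvd a \<and> 11 dvd b) \<and>
     (\<forall>n<26. (\<not> 11 dvd a * int n + b \<longrightarrow> [u11 n (j * int n + i) = a * int n + b] (mod 11)) \<and>
        (\<not> 11 dvd a \<longrightarrow> 11 dvd a * int n + b \<longrightarrow> \<not> 11 dvd a * (int n div 11) + c \<longrightarrow>
          [u11 n (j * int n + i) = a * (int n div 11) + c] (mod 11)))"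
    by (rule exI[of _ a], rule exI[of _ b], rule exI[of _ c]) (use ab 0 1 in blast)
qed

lemma line_rule_13: "line_rule 13 26 u13"
  unfolding line_rule_def
proof (intro allI)
  fix j i
  obtain a b c a' b' c' :: int and s s1 s2 :: nat where ab: "\<not> (13 dvd a' \<and> 13 dvd b')"
    and 0: "\<forall>n<26. \<not> 13 dvd a' * int n + b' \<longrightarrow> [u13 n (j * int n + i) = a' * int n + b'] (mod 13)"
    and 1: "\<forall>n<26. \<not> 13 dvd a' \<longrightarrow> 13 dvd a' * int n + b' \<longrightarrow> \<not> 13 dvd a' * (int n div 13) + c' \<longrightarrow>
      [u13 n (j * int n + i) = a' * (int n div 13) + c'] (mod 13)"
    by (rule line_params[of j i])
  show "\<exists>a b c. \<not> (13 dvd a \<and> 13 dvd b) \<and>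
     (\<forall>n<26. (\<not> 13 dvd a * int n + b \<longrightarrow> [u13 n (j * int n + i) = a * int n + b] (mod 13)) \<and>
        (\<not> 13 dvd a \<longrightarrow> 13 dvd a * int n + b \<longrightarrow> \<not> 13 dvd a * (int n div 13) + c \<longrightarrow>
          [u13 n (j * int n + i) = a * (int n div 13) + c] (mod 13)))"
    by (rule exI[of _ a'], rule exI[of _ b'], rule exI[of _ c']) (use ab 0 1 in blast)
qed

lemma residue_digits:
  assumes "n < 26"
  shows "\<not> 11 dvd int (F (n, m)) \<Longrightarrow> [u11 n m = int (F (n, m))] (mod 11)"
    and "\<not> 13 dvd int (F (n, m)) \<Longrightarrow> [u13 n m = int (F (n, m))] (mod 13)"
proof -
  have *: "(F (n, m) mod 11 \<noteq> 0 \<longrightarrow> digit11 (F (n, m)) = F (n, m) mod 11) \<and>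
        (F (n, m) mod 13 \<noteq> 0 \<longrightarrow> digit13 (F (n, m)) = F (n, m) mod 13)"
    using lines[of 0 m] assms unfolding valid_line_def by simp
  have dvd: "int p dvd int (F (n, m)) \<longleftrightarrow> F (n, m) mod p = 0" for p
    by (simp add: mod_eq_0_iff_dvd)
  show "\<not> 11 dvd int (F (n, m)) \<Longrightarrow> [u11 n m = int (F (n, m))] (mod 11)"
    using * dvd[of 11] by (simp add: u11_def cong_def zmod_int)
  show "\<not> 13 dvd int (F (n, m)) \<Longrightarrow> [u13 n m = int (F (n, m))] (mod 13)"
    using * dvd[of 13] by (simp add: u13_def cong_def zmod_int)
qed

text \<open>The initial condition makes column 0 injective on residues modulo 143. Were
  \<open>c\<close> divisible by 11, then 13 and 0 would have the same image; similarly 11 and 0 for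
  the prime 13.\<close>

lemma linear_form:
  obtains c e d where "\<not> 11 dvd c" "\<not> 13 dvd c"
    "\<And>n m. n < 26 \<Longrightarrow> [int (F (n, m)) = c * m + e * int n + d] (mod 143)"
proof -
  obtain \<sigma> where \<sigma>: "\<sigma> permutes {0..<143}" "\<And>m. F (0, m) mod 143 = \<sigma> (residue 143 m)"
    using columns[of 0] by auto
  have "\<exists>c e d. \<forall>n<26. \<forall>m. [int (F (n, m)) = c * m + e * int n + d] (mod 143)"
  proof (rule affine_of_lines)
    show "\<exists>A B. \<forall>n<26. [int (F (n, j * int n + i)) = A * int n + B] (mod 143)" for j i
    proof -
      obtain A B where "\<forall>n<26. F (n, j * int n + i) mod 143 = (A * n + B) mod 143"
        using lines[of j i] unfolding valid_line_def by blast
      then have "\<forall>n<26. [int (F (n, j * int n + i)) = int A * int n + int B] (mod 143)"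
        unfolding cong_def by (metis of_nat_add of_nat_mod of_nat_mult of_nat_numeral)
      then show ?thesis by blast
    qed
    have "F (0, m + 143) mod 143 = F (0, m) mod 143" for m
      unfolding \<sigma>(2) residue_def by simp
    then show "[int (F (0, m + 143)) = int (F (0, m))] (mod 143)" for m
      unfolding cong_def by (metis of_nat_mod of_nat_numeral)
  qed auto
  then obtain c e d where form: "\<And>n m. n < 26 \<Longrightarrow> [int (F (n, m)) = c * m + e * int n + d] (mod 143)"
    by blast
  have inj: "[x = y] (mod 143)" if "[c * x = c * y] (mod 143)" for x y
  proof -
    have "[int (F (0, x)) = c * x + d] (mod 143)" "[int (F (0, y)) = c * y + d] (mod 143)"
      using form[of 0 x] form[of 0 y] by simp_all
    moreover have "[c * x + d = c * y + d] (mod 143)"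
      by (intro cong_add that cong_refl)
    ultimately have "[int (F (0, x)) = int (F (0, y))] (mod 143)"
      using cong_trans cong_sym by blast
    then have "F (0, x) mod 143 = F (0, y) mod 143"
      using cong_int_iff[of "F (0, x)" "F (0, y)" 143] by (simp add: cong_def)
    then have "residue 143 x = residue 143 y"
      unfolding \<sigma>(2) using permutes_inj[OF \<sigma>(1)] by (auto dest: injD)
    then show ?thesis
      by (simp add: residue_def cong_def)
  qed
  have "\<not> 11 dvd c"
  proof
    assume "11 dvd c"
    then have "[c * 13 = c * 0] (mod 143)" by (auto simp: cong_iff_dvd_diff)
    from inj[OF this] show False by (simp add: cong_def)
  qed
  moreover have "\<not> 13 dvd c"
  proof
    assume "13 dvd c"
    then have "[c * 11 = c * 0] (mod 143)" by (auto simp: cong_iff_dvd_diff)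
    from inj[OF this] show False by (simp add: cong_def)
  qed
  ultimately show thesis using that form by blast
qed

end

text \<open>Inverting \<open>c\<close> modulo \<open>p\<close> solves the linear form for the height
  at which it vanishes, which gives \<open>K\<close> and \<open>L\<close>.\<close>

lemma digit_form_base:
  fixes p c :: int
  assumes p: "prime p" and c: "\<not> p dvd c"
    and w: "\<And>n m. n < N \<Longrightarrow> [w n m = c * m + e * int n + d] (mod p)"
    and u: "\<And>n m. n < N \<Longrightarrow> \<not> p dvd w n m \<Longrightarrow> [u n m = w n m] (mod p)"
  shows "\<exists>K L. digit_form p N u c (Suc 0) K L"
proof -
  have "coprime c p"
    using p c prime_imp_coprime coprime_commute by blast
  then obtain c' where c': "[c * c' = 1] (mod p)"
    using cong_solve_coprime_int by blast
  have "digit_form p N u c (Suc 0) (- c' * e) (- c' * d)"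
    unfolding digit_form_def
  proof (intro allI impI)
    fix n k z assume n: "n < N" "k < Suc 0" "\<not> p dvd z"
    let ?m = "- c' * e * int n + - c' * d + p ^ k * z"
    have "c * ?m + e * int n + d - c * z = - ((c * c' - 1) * (e * int n + d))"
      using n(2) by (simp add: algebra_simps)
    then have "[c * ?m + e * int n + d = c * z] (mod p)"
      using c' by (simp add: cong_iff_dvd_diff)
    then have wz: "[w n ?m = c * z] (mod p)"
      using w[OF n(1)] cong_trans by blast
    moreover have "\<not> p dvd w n ?m"
      using cong_dvd_iff[OF wz] c n(3) p prime_dvd_mult_iff by blast
    ultimately show "[u n ?m = c * z] (mod p)"
      using u[OF n(1)] cong_trans by blast
  qed
  then show ?thesis by blast
qed

text \<open>A form depends on \<open>K\<close> and \<open>L\<close> only modulo the power of its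
  prime, so the Chinese remainder theorem finds values that suit both primes.\<close>

lemma digit_forms_combine:
  fixes p q :: int
  assumes "coprime p q" and form: "digit_form p N u c e K1 L1" "digit_form q N v c e K2 L2"
  obtains K L where "digit_form p N u c e K L" "digit_form q N v c e K L"
    "[L = L1] (mod p ^ e)" "[L = L2] (mod q ^ e)"
proof -
  have coprime: "coprime (p ^ e) (q ^ e)" using assms(1) by simp
  obtain K where K: "[K = K1] (mod p ^ e)" "[K = K2] (mod q ^ e)"
    using binary_chinese_remainder_int[OF coprime] by blast
  obtain L where L: "[L = L1] (mod p ^ e)" "[L = L2] (mod q ^ e)"
    using binary_chinese_remainder_int[OF coprime] by blast
  show thesis
    by (rule that[OF digit_form_cong[OF form(1) cong_sym[OF K(1)] cong_sym[OF L(1)]]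
          digit_form_cong[OF form(2) cong_sym[OF K(2)] cong_sym[OF L(2)]] L])
qed

context puzzle_solution
begin

text \<open>Dependent choice repeats the step for both primes at once. The heights
  \<open>L e\<close> need not be constant, but their congruences make cells chosen at consecutive
  levels comparable.\<close>

lemma digit_form_chain:
  obtains c K L where "\<not> 11 dvd c" "\<not> 13 dvd c"
    "\<And>e. digit_form 11 26 u11 c (Suc e) (K e) (L e)"
    "\<And>e. digit_form 13 26 u13 c (Suc e) (K e) (L e)"
    "\<And>e. [L (Suc e) = L e] (mod 143 ^ Suc e)"
proof -
  have cop: "coprime (11 :: int) 13"
    by (rule primes_coprime) simp_all
  obtain c e d where c: "\<not> 11 dvd c" "\<not> 13 dvd c"
    and form: "\<And>n m. n < 26 \<Longrightarrow> [int (F (n, m)) = c * m + e * int n + d] (mod 143)"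
    by (rule linear_form) (rule that)
  have "n < 26 \<Longrightarrow> [int (F (n, m)) = c * m + e * int n + d] (mod 11)" for n m
    by (rule cong_dvd_modulus[OF form]) auto
  then obtain K1 L1 where 1: "digit_form 11 26 u11 c (Suc 0) K1 L1"
    using digit_form_base[of 11 c 26 "\<lambda>n m. int (F (n, m))" e d u11] c residue_digits(1) by auto
  have "n < 26 \<Longrightarrow> [int (F (n, m)) = c * m + e * int n + d] (mod 13)" for n m
    by (rule cong_dvd_modulus[OF form]) auto
  then obtain K2 L2 where 2: "digit_form 13 26 u13 c (Suc 0) K2 L2"
    using digit_form_base[of 13 c 26 "\<lambda>n m. int (F (n, m))" e d u13] c residue_digits(2) by auto
  define P where "P e KL \<longleftrightarrow> digit_form 11 26 u11 c (Suc e) (fst KL) (snd KL) \<and>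
    digit_form 13 26 u13 c (Suc e) (fst KL) (snd KL)" for e KL
  define Q where "Q e KL KL' \<longleftrightarrow> [snd KL' = snd KL] (mod 143 ^ Suc e)" for e and KL KL' :: "int \<times> int"
  have base: "\<exists>KL. P 0 KL"
    using digit_forms_combine[OF cop 1 2] unfolding P_def by (metis fst_conv snd_conv)
  have step: "\<exists>KL'. P (Suc e) KL' \<and> Q e KL KL'" if "P e KL" for e KL
  proof -
    obtain K L where KL: "KL = (K, L)" by (cases KL)
    with that have f: "digit_form 11 26 u11 c (Suc e) K L" "digit_form 13 26 u13 c (Suc e) K L"
      by (auto simp: P_def)
    obtain k l where 1: "digit_form 11 26 u11 c (Suc (Suc e)) (K + 11 ^ Suc e * k) (L + 11 ^ Suc e * l)"
      by (rule digit_form_step[OF _ _ _ c(1) line_rule_11 f(1)]) simp_all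
    obtain k' l' where 2: "digit_form 13 26 u13 c (Suc (Suc e)) (K + 13 ^ Suc e * k') (L + 13 ^ Suc e * l')"
      by (rule digit_form_step[OF _ _ _ c(2) line_rule_13 f(2)]) simp_all
    obtain K' L' where K': "digit_form 11 26 u11 c (Suc (Suc e)) K' L'"
        "digit_form 13 26 u13 c (Suc (Suc e)) K' L'"
      and L': "[L' = L + 11 ^ Suc e * l] (mod 11 ^ Suc (Suc e))"
        "[L' = L + 13 ^ Suc e * l'] (mod 13 ^ Suc (Suc e))"
      by (rule digit_forms_combine[OF cop 1 2])
    have "[L' = L] (mod p ^ Suc e)" if "[L' = L + p ^ Suc e * l] (mod p ^ Suc (Suc e))" for p l :: int
    proof -
      have "[L' = L + p ^ Suc e * l] (mod p ^ Suc e)"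
        by (rule cong_dvd_modulus[OF that]) (rule le_imp_power_dvd, simp)
      also have "[L + p ^ Suc e * l = L] (mod p ^ Suc e)"
        by (simp add: cong_iff_dvd_diff)
      finally show ?thesis .
    qed
    from this[OF L'(1)] this[OF L'(2)] have "[L' = L] (mod 11 ^ Suc e * 13 ^ Suc e)"
      using cop by (intro coprime_cong_mult) auto
    then have "Q e KL (K', L')"
      unfolding Q_def KL by (simp only: snd_conv power_mult_distrib[symmetric]) simp
    with K' show ?thesis unfolding P_def by (metis fst_conv snd_conv)
  qed
  from dependent_nat_choice[of P Q, OF base step] obtain KL where "\<And>e. P e (KL e)" "\<And>e. Q e (KL e) (KL (Suc e))"
    by blast
  then show thesis
    using that[OF c, of "\<lambda>e. fst (KL e)" "\<lambda>e. snd (KL e)"] unfolding P_def Q_def by blast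
qed

section \<open>Tiles on the sublattices\<close>

text \<open>On a line of invertible slope in the sublattice, both sets of rule parameters are units
  times \<open>s\<close> and \<open>r\<close>, so the entries with \<open>s * n + r\<close> prime to
  143 share a tile. For \<open>r = 11\<close> or \<open>r = 13\<close>, column 0 has the next
  valuation and carries the neighbouring tile.\<close>

lemma sublattice_tiles:
  assumes c: "\<not> 11 dvd c" "\<not> 13 dvd c"
    and form: "digit_form 11 26 u11 c E K L" "digit_form 13 26 u13 c E K L"
    and ij: "Suc i < E" "Suc j < E" and s: "\<not> 11 dvd s" "\<not> 13 dvd s"
  defines "P \<equiv> 11 ^ i * 13 ^ j"
  obtains t t1 t2 where "(t, t1) \<in> R1" "(t, t2) \<in> R2"
    "\<And>n. n < 26 \<Longrightarrow> \<not> 11 dvd s * int n + r \<Longrightarrow> \<not> 13 dvd s * int n + r \<Longrightarrow>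
      tile (F (n, K * int n + L + P * (s * int n + r))) = t"
    "r = 11 \<Longrightarrow> \<not> 11 dvd s + 1 \<Longrightarrow> tile (F (0, L + P * 11)) = t1"
    "r = 13 \<Longrightarrow> \<not> 13 dvd s + 1 \<Longrightarrow> tile (F (0, L + P * 13)) = t2"
proof -
  \<comment> \<open>For each prime its own power comes first and the other factor becomes the
    \<open>Q\<close> of \<open>line_rule_params\<close>.\<close>
  have P11: "P = 11 ^ i * 13 ^ j" and P13: "P = 13 ^ j * 11 ^ i"
    by (simp_all add: P_def)
  have Q11: "\<not> (11 :: int) dvd 13 ^ j" and Q13: "\<not> (13 :: int) dvd 11 ^ i"
    using prime_dvd_power[of "11 :: int" 13 j] prime_dvd_power[of "13 :: int" 11 i] by auto
  obtain a b d a' b' d' :: int and t t1 t2 :: nat where R: "(t, t1) \<in> R1" "(t, t2) \<in> R2"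
    and 11: "\<not> (11 dvd a \<and> 11 dvd b)"
    "\<forall>n<26. \<not> 11 dvd a * int n + b \<longrightarrow>
      [u11 n ((K + P * s) * int n + (L + P * r)) = a * int n + b] (mod 11)"
    "\<forall>n<26. \<not> 11 dvd a \<longrightarrow> 11 dvd a * int n + b \<longrightarrow> \<not> 11 dvd a * (int n div 11) + d \<longrightarrow>
      [u11 n ((K + P * s) * int n + (L + P * r)) = a * (int n div 11) + d] (mod 11)"
    and 13: "\<not> (13 dvd a' \<and> 13 dvd b')"
    "\<forall>n<26. \<not> 13 dvd a' * int n + b' \<longrightarrow>
      [u13 n ((K + P * s) * int n + (L + P * r)) = a' * int n + b'] (mod 13)"
    "\<forall>n<26. \<not> 13 dvd a' \<longrightarrow> 13 dvd a' * int n + b' \<longrightarrow> \<not> 13 dvd a' * (int n div 13) + d' \<longrightarrow>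
      [u13 n ((K + P * s) * int n + (L + P * r)) = a' * (int n div 13) + d'] (mod 13)"
    and tiles: "\<forall>n<26. \<not> 11 dvd a * int n + b \<longrightarrow> \<not> 13 dvd a' * int n + b' \<longrightarrow>
      tile (F (n, (K + P * s) * int n + (L + P * r))) = t"
    "\<not> 11 dvd a \<longrightarrow> 11 dvd b \<longrightarrow> \<not> 11 dvd d \<longrightarrow> \<not> 13 dvd b' \<longrightarrow> tile (F (0, L + P * r)) = t1"
    "\<not> 11 dvd b \<longrightarrow> \<not> 13 dvd a' \<longrightarrow> 13 dvd b' \<longrightarrow> \<not> 13 dvd d' \<longrightarrow> tile (F (0, L + P * r)) = t2"
    by (rule line_params[of "K + P * s" "L + P * r"])
  have ab: "[a = c * 13 ^ j * s] (mod 11) \<and> [b = c * 13 ^ j * r] (mod 11)"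
    by (rule line_rule_params[OF _ _ _ c(1) form(1) _ s(1) Q11 11(1) 11(2)[unfolded P11]])
       (use ij in simp_all)
  have ab': "[a' = c * 11 ^ i * s] (mod 13) \<and> [b' = c * 11 ^ i * r] (mod 13)"
    by (rule line_rule_params[OF _ _ _ c(2) form(2) _ s(2) Q13 13(1) 13(2)[unfolded P13]])
       (use ij in simp_all)
  have unit: "p dvd x * int n + y \<longleftrightarrow> p dvd s * int n + r"
    if "prime p" "\<not> p dvd c * Q" "[x = c * Q * s] (mod p) \<and> [y = c * Q * r] (mod p)"
    for p x y Q :: int and n
  proof -
    have "[x * int n + y = c * Q * s * int n + c * Q * r] (mod p)"
      using that(3) by (intro cong_add cong_mult cong_refl) auto
    then have "p dvd x * int n + y \<longleftrightarrow> p dvd c * Q * (s * int n + r)"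
      by (simp add: cong_dvd_iff algebra_simps)
    then show ?thesis using that prime_dvd_mult_iff by blast
  qed
  have cQ: "\<not> 11 dvd c * 13 ^ j" "\<not> 13 dvd c * 11 ^ i"
    using c Q11 Q13 by (simp_all add: prime_dvd_mult_iff)
  have u11: "11 dvd a * int n + b \<longleftrightarrow> 11 dvd s * int n + r" for n
    by (rule unit[OF _ cQ(1) ab]) simp
  have u13: "13 dvd a' * int n + b' \<longleftrightarrow> 13 dvd s * int n + r" for n
    by (rule unit[OF _ cQ(2) ab']) simp
  have a: "\<not> 11 dvd a" "\<not> 13 dvd a'"
    using cong_dvd_iff[OF conjunct1[OF ab]] cong_dvd_iff[OF conjunct1[OF ab']] cQ s
    by (simp_all add: prime_dvd_mult_iff)
  show thesis
  proof (rule that[OF R])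
    fix n :: nat assume "n < 26" "\<not> 11 dvd s * int n + r" "\<not> 13 dvd s * int n + r"
    moreover have "(K + P * s) * int n + (L + P * r) = K * int n + L + P * (s * int n + r)"
      by (simp add: algebra_simps)
    ultimately show "tile (F (n, K * int n + L + P * (s * int n + r))) = t"
      using tiles(1) u11 u13 by metis
  next
    assume r: "r = 11" and "\<not> 11 dvd s + 1"
    then have "\<not> 11 dvd d"
      by (intro line_rule_offset[OF _ _ _ c(1) form(1) _ Q11 s(1) _ 11(1)
             11(2)[unfolded P11 r] 11(3)[unfolded P11 r]]) (use ij in simp_all)
    then show "tile (F (0, L + P * 11)) = t1"
      using tiles(2) a u11[of 0] u13[of 0] r by simp
  next
    assume r: "r = 13" and "\<not> 13 dvd s + 1"
    then have "\<not> 13 dvd d'"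
      by (intro line_rule_offset[OF _ _ _ c(2) form(2) _ Q13 s(2) _ 13(1)
             13(2)[unfolded P13 r] 13(3)[unfolded P13 r]]) (use ij in simp_all)
    then show "tile (F (0, L + P * 13)) = t2"
      using tiles(3) a u11[of 0] u13[of 0] r by simp
  qed
qed

text \<open>The entries to be compared lie in column 0 at the heights \<open>r = 1 + 143 w\<close>, 11 and 13 of the
  sublattice. Each is joined to the entry at height 3 of column 1 by a line of invertible slope.\<close>

lemma adjacent_tiles:
  assumes c: "\<not> 11 dvd c" "\<not> 13 dvd c"
    and form: "digit_form 11 26 u11 c E K L" "digit_form 13 26 u13 c E K L"
    and ij: "Suc i < E" "Suc j < E"
  defines "P \<equiv> 11 ^ i * 13 ^ j"
  shows "(tile (F (0, L + P * (1 + 143 * w))), tile (F (0, L + P * 11))) \<in> R1"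
    and "(tile (F (0, L + P * (1 + 143 * w))), tile (F (0, L + P * 13))) \<in> R2"
proof -
  note tiles = sublattice_tiles[OF c form ij, folded P_def]
  have d: "\<not> p dvd x + 143 * w'" if "\<not> p dvd x" "p dvd 143" for p x w' :: int
    using that by (simp add: dvd_add_left_iff)
  \<comment> \<open>The slope \<open>2 - 143 * w\<close> leads from height
    \<open>1 + 143 * w\<close> in column 0 to height 3 in column 1.\<close>
  have "\<not> 11 dvd 2 + 143 * (- w)" "\<not> 13 dvd 2 + 143 * (- w)"
    by (rule d; simp)+
  then have s: "\<not> 11 dvd 2 - 143 * w" "\<not> 13 dvd 2 - 143 * w"
    by simp_all
  obtain t where t: "\<And>n. n < 26 \<Longrightarrow> \<not> 11 dvd (2 - 143 * w) * int n + (1 + 143 * w) \<Longrightarrow>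
      \<not> 13 dvd (2 - 143 * w) * int n + (1 + 143 * w) \<Longrightarrow>
      tile (F (n, K * int n + L + P * ((2 - 143 * w) * int n + (1 + 143 * w)))) = t"
    by (rule tiles[OF s, of "1 + 143 * w"]) (rule that)
  have "\<not> 11 dvd 1 + 143 * w" "\<not> 13 dvd 1 + 143 * w"
    by (rule d; simp)+
  then have 0: "tile (F (0, L + P * (1 + 143 * w))) = tile (F (1, K + L + P * 3))"
    using t[of 0] t[of 1] by simp
  \<comment> \<open>Slope -8 leads from 11 to 3, and \<open>s + 1 = -7\<close> is not divisible by
    11.\<close>
  obtain t t1 t2 :: nat where "(t, t1) \<in> R1"
    "\<And>n. n < 26 \<Longrightarrow> \<not> 11 dvd (- 8) * int n + 11 \<Longrightarrow> \<not> 13 dvd (- 8) * int n + 11 \<Longrightarrow>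
      tile (F (n, K * int n + L + P * ((- 8) * int n + 11))) = t"
    "\<not> 11 dvd - 8 + (1 :: int) \<Longrightarrow> tile (F (0, L + P * 11)) = t1"
    by (rule tiles[of "- 8" 11]) (simp, simp, rule that, simp_all)
  from this(1) this(2)[of 1] this(3)
  show "(tile (F (0, L + P * (1 + 143 * w))), tile (F (0, L + P * 11))) \<in> R1"
    unfolding 0 by simp
  \<comment> \<open>Slope -10 leads from 13 to 3, and \<open>s + 1 = -9\<close> is not divisible by
    13.\<close>
  obtain t t1 t2 :: nat where "(t, t2) \<in> R2"
    "\<And>n. n < 26 \<Longrightarrow> \<not> 11 dvd (- 10) * int n + 13 \<Longrightarrow> \<not> 13 dvd (- 10) * int n + 13 \<Longrightarrow>
      tile (F (n, K * int n + L + P * ((- 10) * int n + 13))) = t"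
    "\<not> 13 dvd - 10 + (1 :: int) \<Longrightarrow> tile (F (0, L + P * 13)) = t2"
    by (rule tiles[of "- 10" 13]) (simp, simp, rule that, simp_all)
  from this(1) this(2)[of 1] this(3)
  show "(tile (F (0, L + P * (1 + 143 * w))), tile (F (0, L + P * 13))) \<in> R2"
    unfolding 0 by simp
qed

theorem quadrant_tiling:
  obtains T :: "nat \<Rightarrow> nat \<Rightarrow> nat" where
    "\<And>i j. (T i j, T (Suc i) j) \<in> R1" "\<And>i j. (T i j, T i (Suc j)) \<in> R2"
proof -
  obtain c K L where c: "\<not> 11 dvd c" "\<not> 13 dvd c"
    and f: "\<And>e. digit_form 11 26 u11 c (Suc e) (K e) (L e)"
      "\<And>e. digit_form 13 26 u13 c (Suc e) (K e) (L e)"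
    and L: "\<And>e. [L (Suc e) = L e] (mod 143 ^ Suc e)"
    by (rule digit_form_chain) (rule that)
  \<comment> \<open>The level depends only on \<open>i + j\<close>, so both neighbours of a cell use
    the same next level.\<close>
  define T where "T i j = tile (F (0, L (i + j + 2) + 11 ^ i * 13 ^ j))" for i j
  have "(T i j, T (Suc i) j) \<in> R1 \<and> (T i j, T i (Suc j)) \<in> R2" for i j
  proof -
    define e where "e = i + j + 2"
    define P :: int where "P = 11 ^ i * 13 ^ j"
    have "143 ^ Suc e = P * (143 * (11 ^ (j + 2) * 13 ^ (i + 2)))"
    proof -
      have "(143 :: int) ^ Suc e = 143 * (11 ^ e * 13 ^ e)"
        by (simp flip: power_mult_distrib)
      then show ?thesis by (simp add: e_def P_def power_add algebra_simps)
    qed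
    \<comment> \<open>Passing from \<open>L e\<close> to \<open>L (Suc e)\<close> changes the height
      by a multiple of \<open>143 * P\<close>; the parameter \<open>w\<close> of
      \<open>adjacent_tiles\<close> absorbs it.\<close>
    then obtain w where "L e = L (Suc e) + P * (143 * w)"
      using L[of e] by (metis cong_iff_lin cong_sym mult.assoc)
    then have "L e + P = L (Suc e) + P * (1 + 143 * w)"
      by (simp add: algebra_simps)
    moreover have "Suc i < Suc (Suc e)" "Suc j < Suc (Suc e)"
      by (simp_all add: e_def)
    note adjacent_tiles[OF c f[of "Suc e"] this, of w, folded P_def]
    ultimately show ?thesis
      by (simp add: T_def e_def P_def algebra_simps)
  qed
  then show thesis using that by blast
qed

end

section \<open>From tilings to Sudoku solutions\<close>

lemma affine_mod: "(a mod p * n + b mod p) mod p = (a * n + b) mod p" for a b n p :: int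
  unfolding cong_def[symmetric] by (intro cong_add cong_mult cong_refl) (simp_all add: cong_def)

definition last_digit :: "int \<Rightarrow> int \<Rightarrow> int" where
  "last_digit p x = x div p ^ multiplicity p x mod p"

lemma last_digit_eq:
  fixes p y :: int
  assumes "prime p" "\<not> p dvd y"
  shows "multiplicity p (p ^ k * y) = k" "last_digit p (p ^ k * y) = y mod p"
proof -
  have "p \<noteq> 0" using assms(1) by auto
  show "multiplicity p (p ^ k * y) = k"
    by (rule multiplicity_eqI) (use assms \<open>p \<noteq> 0\<close> in auto)
  then show "last_digit p (p ^ k * y) = y mod p"
    using \<open>p \<noteq> 0\<close> by (simp add: last_digit_def)
qed

lemma last_digit_bounds: "0 < p \<Longrightarrow> 0 \<le> last_digit p x \<and> last_digit p x < p"
  by (simp add: last_digit_def)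

text \<open>Dividing by the exact power of \<open>p\<close> in the gcd leaves coefficients not both
  divisible by \<open>p\<close>. If the slope is then invertible, the roots lie in one residue
  class, on which division by \<open>p\<close> gives an affine function of \<open>n div p\<close>
  with the same slope.\<close>

lemma line_last_digits:
  fixes \<alpha> \<beta> :: int and p :: nat
  assumes p: "prime (int p)" and \<beta>: "\<beta> \<noteq> 0"
  obtains k a b c where "a < p" "b < p" "c < p" "a \<noteq> 0 \<or> b \<noteq> 0"
    "\<And>n. level0 p a b n \<Longrightarrow> multiplicity (int p) (\<alpha> * int n + \<beta>) = k"
    "\<And>n. level0 p a b n \<Longrightarrow> last_digit (int p) (\<alpha> * int n + \<beta>) = int ((a * n + b) mod p)"
    "\<And>n. level1 p a b c n \<Longrightarrow> multiplicity (int p) (\<alpha> * int n + \<beta>) = Suc k"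
    "\<And>n. level1 p a b c n \<Longrightarrow> last_digit (int p) (\<alpha> * int n + \<beta>) = int ((a * (n div p) + c) mod p)"
proof -
  have p0: "0 < p" using p by (cases p) auto
  define k where "k = multiplicity (int p) (gcd \<alpha> \<beta>)"
  have g0: "gcd \<alpha> \<beta> \<noteq> 0" using \<beta> by simp
  have "int p ^ k dvd gcd \<alpha> \<beta>" unfolding k_def by (rule multiplicity_dvd)
  then obtain \<alpha>' \<beta>' where \<alpha>\<beta>: "\<alpha> = int p ^ k * \<alpha>'" "\<beta> = int p ^ k * \<beta>'"
    by (metis dvdE dvd_trans gcd_dvd1 gcd_dvd2)
  have prim: "\<not> (int p dvd \<alpha>' \<and> int p dvd \<beta>')"
  proof
    assume "int p dvd \<alpha>' \<and> int p dvd \<beta>'"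
    then have "int p ^ Suc k dvd gcd \<alpha> \<beta>"
      unfolding \<alpha>\<beta> power_Suc2 by (intro gcd_greatest mult_dvd_mono) auto
    then have "Suc k \<le> multiplicity (int p) (gcd \<alpha> \<beta>)"
      using g0 p by (subst (asm) power_dvd_iff_le_multiplicity) auto
    then show False by (simp add: k_def)
  qed
  define a b where "a = nat (\<alpha>' mod int p)" and "b = nat (\<beta>' mod int p)"
  have a: "int a = \<alpha>' mod int p" and b: "int b = \<beta>' mod int p"
    using p0 by (simp_all add: a_def b_def)
  have ab: "int ((a * n + b) mod p) = (\<alpha>' * int n + \<beta>') mod int p" for n
    by (simp only: zmod_int of_nat_add of_nat_mult a b affine_mod)
  \<comment> \<open>The constant is \<open>(\<alpha>' * r + \<beta>') div p\<close>, with
    \<open>r\<close> the residue of any root; without roots every \<open>z\<close> will do.\<close>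
  obtain z where z: "\<And>n :: nat. \<not> int p dvd \<alpha>' \<Longrightarrow> int p dvd \<alpha>' * int n + \<beta>' \<Longrightarrow>
      \<alpha>' * int n + \<beta>' = int p * (\<alpha>' * int (n div p) + z)"
  proof (cases "\<exists>n :: nat. int p dvd \<alpha>' * int n + \<beta>'")
    case True
    then obtain n1 :: nat where n1: "int p dvd \<alpha>' * int n1 + \<beta>'" by blast
    define r where "r = int n1 mod int p"
    show thesis
    proof (rule that)
      fix n :: nat assume \<alpha>': "\<not> int p dvd \<alpha>'" and n: "int p dvd \<alpha>' * int n + \<beta>'"
      have "int p dvd \<alpha>' * (int n - int n1)"
        using dvd_diff[OF n n1] by (simp add: algebra_simps)
      then have "int p dvd int n - int n1"
        using \<alpha>' p prime_dvd_mult_iff by blast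
      then have "int n mod int p = r"
        unfolding r_def by (simp add: mod_eq_dvd_iff)
      then have nr: "int n = int p * int (n div p) + r"
        by (metis mult_div_mod_eq zdiv_int)
      then have "\<alpha>' * int n + \<beta>' = int p * (\<alpha>' * int (n div p)) + (\<alpha>' * r + \<beta>')"
        by (simp add: algebra_simps)
      moreover from this have "int p dvd \<alpha>' * r + \<beta>'"
        using n by (metis dvd_add_right_iff dvd_triv_left)
      ultimately show "\<alpha>' * int n + \<beta>' = int p * (\<alpha>' * int (n div p) + (\<alpha>' * r + \<beta>') div int p)"
        by (simp add: distrib_left)
    qed
  qed (use that in blast)
  define c where "c = nat (z mod int p)"
  have ac: "int ((a * n + c) mod p) = (\<alpha>' * int n + z) mod int p" for n
  proof -
    have "int c = z mod int p" using p0 by (simp add: c_def)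
    then show ?thesis by (simp only: zmod_int of_nat_add of_nat_mult a affine_mod)
  qed
  have line: "\<alpha> * int n + \<beta> = int p ^ k * (\<alpha>' * int n + \<beta>')" for n
    by (simp add: \<alpha>\<beta> algebra_simps)
  have level0: "level0 p a b n \<longleftrightarrow> \<not> int p dvd \<alpha>' * int n + \<beta>'" for n
    unfolding level0_def by (metis ab mod_eq_0_iff_dvd of_nat_eq_0_iff)
  have level1: "\<alpha> * int n + \<beta> = int p ^ Suc k * (\<alpha>' * int (n div p) + z)"
      "\<not> int p dvd \<alpha>' * int (n div p) + z" if "level1 p a b c n" for n
  proof -
    have "\<not> int p dvd \<alpha>'"
      using that a unfolding level1_def by auto
    moreover have "int p dvd \<alpha>' * int n + \<beta>'"
      using that level0[of n] by (simp add: level1_def level0_def)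
    ultimately have "\<alpha>' * int n + \<beta>' = int p * (\<alpha>' * int (n div p) + z)"
      by (rule z)
    then show "\<alpha> * int n + \<beta> = int p ^ Suc k * (\<alpha>' * int (n div p) + z)"
      unfolding line by simp
    show "\<not> int p dvd \<alpha>' * int (n div p) + z"
      using that unfolding level1_def by (metis ac mod_eq_0_iff_dvd of_nat_eq_0_iff)
  qed
  show thesis
  proof (rule that[of a b c k])
    show "a < p" "b < p" "c < p"
      using p0 by (simp_all add: a_def b_def c_def nat_less_iff)
    show "a \<noteq> 0 \<or> b \<noteq> 0"
      using prim a b by (metis mod_eq_0_iff_dvd of_nat_0)
    show "multiplicity (int p) (\<alpha> * int n + \<beta>) = k" if "level0 p a b n" for n
      using that level0 line last_digit_eq(1)[OF p] by simp
    show "last_digit (int p) (\<alpha> * int n + \<beta>) = int ((a * n + b) mod p)" if "level0 p a b n" for n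
      using that level0 line last_digit_eq(2)[OF p] ab by simp
    show "multiplicity (int p) (\<alpha> * int n + \<beta>) = Suc k" if "level1 p a b c n" for n
      using level1[OF that] last_digit_eq(1)[OF p] by metis
    show "last_digit (int p) (\<alpha> * int n + \<beta>) = int ((a * (n div p) + c) mod p)"
      if "level1 p a b c n" for n
      using level1[OF that] last_digit_eq(2)[OF p] ac by metis
  qed
qed

section \<open>The solution built from a tiling\<close>

definition pack :: "nat \<Rightarrow> nat \<Rightarrow> nat \<Rightarrow> nat \<Rightarrow> nat" where
  "pack l u v t = l + 143 * (u + 11 * (v + 13 * t))"

lemma pack_fields:
  assumes "l < 143" "u < 11" "v < 13"
  shows "pack l u v t mod 143 = l" "digit11 (pack l u v t) = u" "digit13 (pack l u v t) = v"
    "tile (pack l u v t) = t"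
proof -
  have "pack l u v t div 143 = u + 11 * (v + 13 * t)"
    using assms(1) by (simp add: pack_def)
  moreover have "d div 1573 = d div 143 div 11" "d div 20449 = d div 143 div 11 div 13" for d :: nat
    by (simp_all add: div_mult2_eq[symmetric])
  moreover have "(u + 11 * w) mod 11 = u" "(u + 11 * w) div 11 = w"
      "(v + 13 * w) mod 13 = v" "(v + 13 * w) div 13 = w" for w
    using assms by simp_all
  ultimately show "digit11 (pack l u v t) = u" "digit13 (pack l u v t) = v" "tile (pack l u v t) = t"
    by (simp_all only: digit11_def digit13_def tile_def)
  show "pack l u v t mod 143 = l"
    unfolding pack_def mod_mult_self2 using assms(1) by (rule mod_less)
qed

text \<open>The entry depends on the height alone. As \<open>2 * m + 1\<close> is odd it never
  vanishes, so it has finite valuations and a last nonzero digit at every height.\<close>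

definition solution_of :: "(nat \<Rightarrow> nat \<Rightarrow> nat) \<Rightarrow> nat \<times> int \<Rightarrow> nat" where
  "solution_of T = (\<lambda>(n, m). let x = 2 * m + 1 in
     pack (nat (x mod 143)) (nat (last_digit 11 x)) (nat (last_digit 13 x))
       (T (multiplicity 11 x) (multiplicity 13 x)))"

lemma solution_of_fields:
  fixes m :: int
  defines "x \<equiv> 2 * m + 1"
  shows "solution_of T (n, m) mod 143 = nat (x mod 143)"
    "int (digit11 (solution_of T (n, m))) = last_digit 11 x"
    "int (digit13 (solution_of T (n, m))) = last_digit 13 x"
    "tile (solution_of T (n, m)) = T (multiplicity 11 x) (multiplicity 13 x)"
proof -
  have "nat (x mod 143) < 143" "nat (last_digit 11 x) < 11" "nat (last_digit 13 x) < 13"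
    using last_digit_bounds[of 11 x] last_digit_bounds[of 13 x] by (simp_all add: nat_less_iff)
  note * = pack_fields[OF this]
  have F: "solution_of T (n, m) = pack (nat (x mod 143)) (nat (last_digit 11 x))
      (nat (last_digit 13 x)) (T (multiplicity 11 x) (multiplicity 13 x))"
    by (simp add: solution_of_def x_def Let_def)
  show "solution_of T (n, m) mod 143 = nat (x mod 143)"
    "int (digit11 (solution_of T (n, m))) = last_digit 11 x"
    "int (digit13 (solution_of T (n, m))) = last_digit 13 x"
    "tile (solution_of T (n, m)) = T (multiplicity 11 x) (multiplicity 13 x)"
    unfolding F * using last_digit_bounds[of 11 x] last_digit_bounds[of 13 x] by simp_all
qed

text \<open>Along the line \<open>2 * m + 1\<close> is an affine function \<open>x n\<close>.
  \<open>line_last_digits\<close> for 11 and 13 supplies the parameters and the valuations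
  \<open>k\<close> and \<open>k'\<close>, and the three tiles are \<open>T\<close> at
  \<open>(k, k')\<close> and at its two successors.\<close>

lemma solution_of_valid_line:
  assumes T: "\<And>i j. T i j < M" "\<And>i j. (T i j, T (Suc i) j) \<in> R1" "\<And>i j. (T i j, T i (Suc j)) \<in> R2"
  shows "valid_line M R1 R2 (\<lambda>n. solution_of T (n, j * int n + i))"
proof -
  define x where "x n = 2 * j * int n + (2 * i + 1)" for n
  let ?g = "\<lambda>n. solution_of T (n, j * int n + i)"
  have xn: "2 * (j * int n + i) + 1 = x n" for n
    by (simp add: x_def)
  note field = solution_of_fields[where m = "j * int n + i" and T = T and n = n for n, unfolded xn]
  have odd: "2 * i + 1 \<noteq> 0" by presburger
  obtain k a b c where 11: "a < 11" "b < 11" "c < 11" "a \<noteq> 0 \<or> b \<noteq> 0"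
    "\<And>n. level0 11 a b n \<Longrightarrow> multiplicity 11 (x n) = k"
    "\<And>n. level0 11 a b n \<Longrightarrow> last_digit 11 (x n) = int ((a * n + b) mod 11)"
    "\<And>n. level1 11 a b c n \<Longrightarrow> multiplicity 11 (x n) = Suc k"
    "\<And>n. level1 11 a b c n \<Longrightarrow> last_digit 11 (x n) = int ((a * (n div 11) + c) mod 11)"
    by (rule line_last_digits[of 11 "2 * i + 1" "2 * j", folded x_def, unfolded of_nat_numeral])
       (simp, rule odd, rule that)
  obtain k' a' b' c' where 13: "a' < 13" "b' < 13" "c' < 13" "a' \<noteq> 0 \<or> b' \<noteq> 0"
    "\<And>n. level0 13 a' b' n \<Longrightarrow> multiplicity 13 (x n) = k'"
    "\<And>n. level0 13 a' b' n \<Longrightarrow> last_digit 13 (x n) = int ((a' * n + b') mod 13)"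
    "\<And>n. level1 13 a' b' c' n \<Longrightarrow> multiplicity 13 (x n) = Suc k'"
    "\<And>n. level1 13 a' b' c' n \<Longrightarrow> last_digit 13 (x n) = int ((a' * (n div 13) + c') mod 13)"
    by (rule line_last_digits[of 13 "2 * i + 1" "2 * j", folded x_def, unfolded of_nat_numeral])
       (simp, rule odd, rule that)
  have linear: "?g n mod 143 = (nat (2 * j mod 143) * n + nat ((2 * i + 1) mod 143)) mod 143" for n
  proof -
    have "int (nat (2 * j mod 143)) = 2 * j mod 143" "int (nat ((2 * i + 1) mod 143)) = (2 * i + 1) mod 143"
      by simp_all
    then have "int ((nat (2 * j mod 143) * n + nat ((2 * i + 1) mod 143)) mod 143) = x n mod 143"
      by (simp only: zmod_int of_nat_add of_nat_mult of_nat_numeral affine_mod x_def)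
    then show ?thesis unfolding field by (metis nat_int)
  qed
  have residue: "int (?g n mod p) = x n mod int p" if "p dvd 143" for n p
  proof -
    have "int (?g n mod 143) = x n mod 143"
      unfolding field by simp
    moreover have "?g n mod 143 mod p = ?g n mod p" "x n mod 143 mod int p = x n mod int p"
      using that int_dvd_int_iff[of p 143] by (simp_all add: mod_mod_cancel)
    ultimately show ?thesis by (metis of_nat_mod)
  qed
  have base: "last_digit p (x n) = x n mod p" if "prime p" "x n mod p \<noteq> 0" for p n
    using last_digit_eq(2)[of p "x n" 0] that by (simp add: mod_eq_0_iff_dvd)
  show ?thesis
    unfolding valid_line_def
  proof (intro conjI)
    show "\<exists>A<143. \<exists>B<143. \<forall>n<26. ?g n mod 143 = (A * n + B) mod 143"
      by (rule exI[of _ "nat (2 * j mod 143)"], intro conjI, simp add: nat_less_iff,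
          rule exI[of _ "nat ((2 * i + 1) mod 143)"], intro conjI allI impI linear)
         (simp add: nat_less_iff)
    have "digit11 (?g n) = ?g n mod 11" if "?g n mod 11 \<noteq> 0" for n
      using field(2)[of n] residue[of 11 n] base[of 11 n] that by simp
    moreover have "digit13 (?g n) = ?g n mod 13" if "?g n mod 13 \<noteq> 0" for n
      using field(3)[of n] residue[of 13 n] base[of 13 n] that by simp
    ultimately show "\<forall>n<26. (?g n mod 11 \<noteq> 0 \<longrightarrow> digit11 (?g n) = ?g n mod 11) \<and>
        (?g n mod 13 \<noteq> 0 \<longrightarrow> digit13 (?g n) = ?g n mod 13)"
      by blast
    have fit: "fits 11 a b c n (digit11 (?g n))" "fits 13 a' b' c' n (digit13 (?g n))" for n
      using field(2,3)[of n] 11(6,8)[of n] 13(6,8)[of n] unfolding fits_def by (auto simp only: of_nat_eq_iff)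
    have tiles: "tiles_fit a b c a' b' c' (T k k') (T (Suc k) k') (T k (Suc k')) n (tile (?g n))" for n
      using field(4)[of n] 11(5,7) 13(5,7) unfolding tiles_fit_def by simp
    show "\<exists>a<11. \<exists>b<11. \<exists>c<11. \<exists>a'<13. \<exists>b'<13. \<exists>c'<13. \<exists>s<M. \<exists>s1<M. \<exists>s2<M.
        (a \<noteq> 0 \<or> b \<noteq> 0) \<and> (a' \<noteq> 0 \<or> b' \<noteq> 0) \<and> (s, s1) \<in> R1 \<and> (s, s2) \<in> R2 \<and>
        (\<forall>n<26. fits 11 a b c n (digit11 (?g n)) \<and> fits 13 a' b' c' n (digit13 (?g n)) \<and>
          tiles_fit a b c a' b' c' s s1 s2 n (tile (?g n)))"
      by (rule exI[of _ a], rule conjI[OF 11(1)], rule exI[of _ b], rule conjI[OF 11(2)],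
          rule exI[of _ c], rule conjI[OF 11(3)], rule exI[of _ a'], rule conjI[OF 13(1)],
          rule exI[of _ b'], rule conjI[OF 13(2)], rule exI[of _ c'], rule conjI[OF 13(3)],
          rule exI[of _ "T k k'"], rule conjI[OF T(1)],
          rule exI[of _ "T (Suc k) k'"], rule conjI[OF T(1)],
          rule exI[of _ "T k (Suc k')"], rule conjI[OF T(1)])
         (intro conjI allI impI T(2,3) 11(4) 13(4) fit tiles)
  qed
qed

text \<open>2 is invertible modulo 143; this permutation witnesses the initial condition, because
  the entry at height \<open>m\<close> has the residue of \<open>2 * m + 1\<close>.\<close>

lemma permutes_double_plus_one:
  "(\<lambda>r :: nat. if r < 143 then (2 * r + 1) mod 143 else r) permutes {0..<143}" (is "?\<sigma> permutes ?S")
proof (rule bij_imp_permutes)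
  have "inj_on ?\<sigma> ?S"
  proof (rule inj_onI)
    fix r r' assume "r \<in> ?S" "r' \<in> ?S" "?\<sigma> r = ?\<sigma> r'"
    then have "r < 143" "r' < 143" "(2 * r + 1) mod 143 = (2 * r' + 1) mod 143" by simp_all
    then have "[2 * r + 1 = 2 * r' + 1] (mod 143)" by (simp only: cong_def)
    then have "[2 * r = 2 * r'] (mod 143)" by (simp only: cong_add_rcancel_nat)
    then have "[r = r'] (mod 143)" by (subst (asm) cong_mult_lcancel_nat) simp_all
    then show "r = r'" using \<open>r < 143\<close> \<open>r' < 143\<close> by (rule cong_less_modulus_unique_nat)
  qed
  moreover have "?\<sigma> ` ?S \<subseteq> ?S" by auto
  ultimately show "bij_betw ?\<sigma> ?S ?S"
    unfolding bij_betw_def using endo_inj_surj by blast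
qed auto

lemma sudoku_solvable_of_tiling:
  assumes T: "\<And>i j. T i j < M" "\<And>i j. (T i j, T (Suc i) j) \<in> R1" "\<And>i j. (T i j, T i (Suc j)) \<in> R2"
  shows "sudoku_solvable 26 (puzzle_digits M) (puzzle_rule M R1 R2) 143 (puzzle_init M)"
proof -
  let ?F = "solution_of T"
  have digits: "?F e \<in> puzzle_digits M" for e
  proof -
    obtain n m where e: "e = (n, m)" by (cases e)
    have "?F e div 20449 < M"
      using T(1) solution_of_fields(4)[of T n m] by (simp add: e tile_def)
    then show ?thesis
      by (simp add: puzzle_digits_def div_less_iff_less_mult mult.commute)
  qed
  have "sudoku_solution 26 (puzzle_digits M) (puzzle_rule M R1 R2) ?F"
    unfolding sudoku_solution_def puzzle_rule_def
  proof (intro conjI allI CollectI)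
    show "valid_line M R1 R2 (\<lambda>n\<in>{0..<26}. ?F (n, j * int n + i))" for j i
      using solution_of_valid_line[of T M R1 R2 j i, OF T]
        valid_line_cong[of "\<lambda>n\<in>{0..<26}. ?F (n, j * int n + i)" "\<lambda>n. ?F (n, j * int n + i)"]
      by simp
  qed (auto intro: digits)
  moreover have "obeys 26 143 (puzzle_init M) ?F"
  proof -
    let ?\<sigma> = "\<lambda>r :: nat. if r < 143 then (2 * r + 1) mod 143 else r"
    have "(?\<sigma> (residue 143 m), ?F (n, m)) \<in> puzzle_init M" for n m
    proof -
      have r: "residue 143 m < 143" by (simp add: residue_def nat_less_iff)
      have "(2 * (m mod 143) + 1) mod 143 = (2 * m + 1) mod 143"
        unfolding cong_def[symmetric] by (intro cong_add cong_mult cong_refl) (simp add: cong_def)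
      moreover have "int (residue 143 m) = m mod 143"
        by (simp add: residue_def)
      ultimately have "int ((2 * residue 143 m + 1) mod 143) = (2 * m + 1) mod 143"
        by (simp only: zmod_int of_nat_add of_nat_mult of_nat_numeral of_nat_1)
      then have "?F (n, m) mod 143 = ?\<sigma> (residue 143 m)"
        unfolding solution_of_fields(1) using r by (metis nat_int)
      then show ?thesis
        using digits r by (simp add: puzzle_init_def)
    qed
    then show ?thesis
      unfolding obeys_def using permutes_double_plus_one by blast
  qed
  ultimately show ?thesis
    unfolding sudoku_solvable_def by blast
qed

section \<open>The equivalence and the algorithm\<close>

lemma tiling_of_sudoku_solvable:
  assumes "sudoku_solvable 26 (puzzle_digits M) (puzzle_rule M R1 R2) 143 (puzzle_init M)"
  obtains T :: "nat \<Rightarrow> nat \<Rightarrow> nat" where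
    "\<And>i j. (T i j, T (Suc i) j) \<in> R1" "\<And>i j. (T i j, T i (Suc j)) \<in> R2"
proof -
  from assms obtain F where
    F: "sudoku_solution 26 (puzzle_digits M) (puzzle_rule M R1 R2) F" "obeys 26 143 (puzzle_init M) F"
    unfolding sudoku_solvable_def by blast
  interpret puzzle_solution M R1 R2 F
  proof
    show "valid_line M R1 R2 (\<lambda>n. F (n, j * int n + i))" for j i
      using F(1) valid_line_cong[of "\<lambda>n\<in>{0..<26}. F (n, j * int n + i)" "\<lambda>n. F (n, j * int n + i)" M R1 R2]
      unfolding sudoku_solution_def puzzle_rule_def by simp
    show "\<exists>\<sigma>. \<sigma> permutes {0..<143} \<and> (\<forall>m. F (n, m) mod 143 = \<sigma> (residue 143 m))" if "n < 26" for n
      using F(2) that unfolding obeys_def puzzle_init_def by fastforce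
  qed
  show thesis by (rule quadrant_tiling) (rule that)
qed

theorem domino_solvable_iff_sudoku_solvable:
  assumes "domino_set W R1 R2"
  defines "M \<equiv> set_encode W"
  shows "domino_solvable W R1 R2 quadrant \<longleftrightarrow>
    sudoku_solvable 26 (puzzle_digits M) (puzzle_rule M R1 R2) 143 (puzzle_init M)"
proof
  assume "domino_solvable W R1 R2 quadrant"
  then obtain T where T: "domino_function W R1 R2 quadrant T"
    unfolding domino_solvable_def by blast
  define T' where "T' i j = T (int i, int j)" for i j
  have mem: "(int i, int j) \<in> quadrant" for i j by (simp add: quadrant_def)
  have "T' i j < M" for i j
    using T mem assms(1) less_set_encode unfolding T'_def M_def domino_function_def domino_set_def
    by blast
  moreover have "(T' i j, T' (Suc i) j) \<in> R1" "(T' i j, T' i (Suc j)) \<in> R2" for i j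
  proof -
    have Suc: "(int (Suc i), int j) = (int i, int j) + e1" "(int i, int (Suc j)) = (int i, int j) + e2"
      by simp_all
    show "(T' i j, T' (Suc i) j) \<in> R1" "(T' i j, T' i (Suc j)) \<in> R2"
      using T mem[of i j] mem[of "Suc i" j] mem[of i "Suc j"]
      unfolding T'_def domino_function_def Suc by blast+
  qed
  ultimately show "sudoku_solvable 26 (puzzle_digits M) (puzzle_rule M R1 R2) 143 (puzzle_init M)"
    by (rule sudoku_solvable_of_tiling)
next
  assume "sudoku_solvable 26 (puzzle_digits M) (puzzle_rule M R1 R2) 143 (puzzle_init M)"
  then obtain T :: "nat \<Rightarrow> nat \<Rightarrow> nat" where
    T: "\<And>i j. (T i j, T (Suc i) j) \<in> R1" "\<And>i j. (T i j, T i (Suc j)) \<in> R2"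
    by (rule tiling_of_sudoku_solvable) (rule that)
  have "domino_function W R1 R2 quadrant (\<lambda>(x, y). T (nat x) (nat y))"
    unfolding domino_function_def
  proof (intro conjI allI impI)
    \<comment> \<open>Digits may carry any tile below \<open>M\<close>, but each
      \<open>T i j\<close> is the first component of a pair in \<open>R1\<close>, hence lies in
      \<open>W\<close>.\<close>
    have "T i j \<in> W" for i j
      using T(1)[of i j] assms(1) unfolding domino_set_def by blast
    then show "(\<lambda>(x, y). T (nat x) (nat y)) \<in> quadrant \<rightarrow> W" by auto
    fix s assume "s \<in> quadrant"
    then obtain x y where s: "s = (x, y)" "0 \<le> x" "0 \<le> y" by (auto simp: quadrant_def)
    show "((\<lambda>(x, y). T (nat x) (nat y)) s, (\<lambda>(x, y). T (nat x) (nat y)) (s + e1)) \<in> R1"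
      using T(1)[of "nat x" "nat y"] s by (simp add: nat_add_distrib)
    show "((\<lambda>(x, y). T (nat x) (nat y)) s, (\<lambda>(x, y). T (nat x) (nat y)) (s + e2)) \<in> R2"
      using T(2)[of "nat x" "nat y"] s by (simp add: nat_add_distrib)
  qed
  then show "domino_solvable W R1 R2 quadrant"
    unfolding domino_solvable_def by blast
qed

theorem theorem3p2:
  shows "\<exists>algorithm :: recf. \<forall>(W :: nat set) R1 R2. domino_set W R1 R2 \<longrightarrow>
    (\<exists>(N :: nat) (D :: nat set) S (q :: nat) C.
       sudoku_rule N D S \<and> initial_condition q D C \<and>
       evaluates algorithm [domino_code W R1 R2] (puzzle_code N D S q C) \<and>
       (domino_solvable W R1 R2 quadrant \<longleftrightarrow> sudoku_solvable N D S q C))"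
proof -
  obtain alg where "\<And>W R1 R2. domino_set W R1 R2 \<Longrightarrow> evaluates alg [domino_code W R1 R2]
    (puzzle_code 26 (puzzle_digits (set_encode W)) (puzzle_rule (set_encode W) R1 R2)
      143 (puzzle_init (set_encode W)))"
    by (rule puzzle_algorithm) (rule that)
  then show ?thesis
    using puzzle_wf domino_solvable_iff_sudoku_solvable by blast
qed

end
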